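(* Let $\mathcal{S}$ be a convex translation surface. Then the (classes of the) periodic orbits of the geodesic flow on $\mathcal{S}$ generate $H_1(\mathcal{S},\mathbb{Z})$.
   Context: A translation surface is a triple $(\mathcal{S},\Sigma,\omega)$, where $\mathcal{S}$ is a compact connected topological surface, $\Sigma$ is a finite subset of $\mathcal{S}$ (its elements are called singularities) and $\omega=(U_i,\phi_i)_{i\in I}$ is an atlas of $\mathcal{S}\setminus\Sigma$, consistent with the topology of $\mathcal{S}$, whose transition maps are translations of $\mathbb{R}^2$. This atlas gives $\mathcal{S}\setminus\Sigma$ a flat Riemannian structure, and $\mathcal{S}$ is assumed to be the completion of $\mathcal{S}\setminus\Sigma$ for this metric. For $\theta\in\mathbb{S}^1$, the directional flow $\phi_\theta$ moves points at unit speed along straight lines of direction $\theta$ (direction being read in the charts; trajectories hitting a singularity are not continued). A periodic orbit (of the geodesic flow) is a closed orbit in $\mathcal{S}\setminus\Sigma$ of some directional flow $\phi_\theta$, $\theta\in\mathbb{S}^1$; it is an oriented closed curve and so has a class in $H_1(\mathcal{S},\mathbb{Z})$. Let $P$ be a simply connected polygon of $\mathbb{R}^2$ whose edges are grouped in pairs such that two edges in the same pair have the same length and direction but opposite orientation (for the orientation of the boundary of $P$ induced by the canonical orientation of $\mathbb{R}^2$). A geometrical side of $P$ may be subdivided into more than one edge (so angles equal to $\pi$ at vertices are allowed; e.g. a rectangle can have more than four edges). $P$ is a pattern of $\mathcal{S}$ if $\mathcal{S}$ can be obtained from $P$ by identifying the edges in each pair by translation (the singularities of $\mathcal{S}$ are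 therefore located at some vertices of $P$). A translation surface is convex if it admits a pattern that is convex. *)

theory Defs
  imports "HOL-Analysis.Analysis" "HOL-Homology.Homology"
begin

text \<open>The Euclidean plane is represented by the type \<^typ>\<open>complex\<close>, and directions by
  complex numbers of modulus 1.\<close>

definition topological_surface :: "'a topology \<Rightarrow> bool" where
  "topological_surface X \<longleftrightarrow>
     Hausdorff_space X \<and> second_countable X \<and>
     (\<forall>x \<in> topspace X. \<exists>U. openin X U \<and> x \<in> U \<and>
        (\<exists>V :: complex set. open V \<and> subtopology X U homeomorphic_space top_of_set V))"

text \<open>A chart is a pair \<open>(U, \<phi>)\<close>; only the restriction of \<open>\<phi>\<close> to \<open>U\<close> is relevant.\<close>

type_synonym 'a plane_chart = "'a set \<times> ('a \<Rightarrow> complex)"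

definition translation_atlas :: "'a topology \<Rightarrow> 'a plane_chart set \<Rightarrow> bool" where
  "translation_atlas Y A \<longleftrightarrow>
     (\<Union>(U, \<phi>) \<in> A. U) = topspace Y \<and>
     (\<forall>(U, \<phi>) \<in> A. openin Y U \<and> open (\<phi> ` U) \<and>
        homeomorphic_map (subtopology Y U) (top_of_set (\<phi> ` U)) \<phi>) \<and>
     (\<forall>(U, \<phi>) \<in> A. \<forall>(V, \<psi>) \<in> A. \<exists>c. \<forall>x \<in> U \<inter> V. \<psi> x = \<phi> x + c)"

definition piecewise_C1_path :: "'a topology \<Rightarrow> 'a plane_chart set \<Rightarrow> (real \<Rightarrow> 'a) \<Rightarrow> bool" where
  "piecewise_C1_path Y A g \<longleftrightarrow>
     pathin Y g \<and>
     (\<forall>(U, \<phi>) \<in> A. \<forall>a b. 0 \<le> a \<and> a \<le> b \<and> b \<le> 1 \<and> g ` {a..b} \<subseteq> U \<longrightarrow>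
        (\<phi> \<circ> g) piecewise_C1_differentiable_on {a..b})"

text \<open>The norm of the velocity in the flat Riemannian metric. The choice of the chart is
  irrelevant, since two charts differ by a constant near \<open>g t\<close>.\<close>

definition flat_speed :: "'a plane_chart set \<Rightarrow> (real \<Rightarrow> 'a) \<Rightarrow> real \<Rightarrow> real" where
  "flat_speed A g t =
     norm (vector_derivative (snd (SOME c. c \<in> A \<and> g t \<in> fst c) \<circ> g) (at t))"

text \<open>The library's notion of piecewise \<open>C\<^sup>1\<close> does not bound the derivative near the exceptional
  points, so a path may fail to be rectifiable; \<open>has_integral\<close> discards such paths.\<close>

definition flat_dist :: "'a topology \<Rightarrow> 'a plane_chart set \<Rightarrow> 'a \<Rightarrow> 'a \<Rightarrow> real" where
  "flat_dist Y A x y =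
     Inf {l. \<exists>g. piecewise_C1_path Y A g \<and> g 0 = x \<and> g 1 = y \<and>
                 (flat_speed A g has_integral l) {0..1}}"

abbreviation regular_part :: "'a topology \<Rightarrow> 'a set \<Rightarrow> 'a topology" where
  "regular_part X Sing \<equiv> subtopology X (topspace X - Sing)"

text \<open>The last conjunct says that \<open>X\<close> is the metric completion of the complement of the
  singularities.\<close>

definition translation_surface ::
    "'a topology \<Rightarrow> 'a set \<Rightarrow> 'a plane_chart set \<Rightarrow> bool" where
  "translation_surface X Sing A \<longleftrightarrow>
     topological_surface X \<and> topspace X \<noteq> {} \<and> compact_space X \<and> connected_space X \<and>
     finite Sing \<and> Sing \<subseteq> topspace X \<and>
     translation_atlas (regular_part X Sing) A \<and>
     (\<exists>d. Metric_space (topspace X) d \<and>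
          Metric_space.mtopology (topspace X) d = X \<and>
          Metric_space.mcomplete (topspace X) d \<and>
          X closure_of (topspace X - Sing) = topspace X \<and>
          (\<forall>x \<in> topspace X - Sing. \<forall>y \<in> topspace X - Sing.
             d x y = flat_dist (regular_part X Sing) A x y))"

text \<open>Trajectories that hit a singularity are not continued, so they are not defined for all
  times and excluded here.\<close>

definition flow_trajectory ::
    "'a topology \<Rightarrow> 'a set \<Rightarrow> 'a plane_chart set \<Rightarrow> complex \<Rightarrow> (real \<Rightarrow> 'a) \<Rightarrow> bool" where
  "flow_trajectory X Sing A \<theta> \<gamma> \<longleftrightarrow>
     continuous_map euclideanreal (regular_part X Sing) \<gamma> \<and>
     (\<forall>(U, \<phi>) \<in> A. \<forall>a b. a \<le> b \<and> \<gamma> ` {a..b} \<subseteq> U \<longrightarrow>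
        \<phi> (\<gamma> b) = \<phi> (\<gamma> a) + of_real (b - a) * \<theta>)"

text \<open>\<open>T\<close> is the least positive period, so that \<open>\<gamma>\<close> on \<open>{0..T}\<close> runs through the orbit once.\<close>

definition periodic_orbit ::
    "'a topology \<Rightarrow> 'a set \<Rightarrow> 'a plane_chart set \<Rightarrow> complex \<Rightarrow> real \<Rightarrow> (real \<Rightarrow> 'a) \<Rightarrow> bool" where
  "periodic_orbit X Sing A \<theta> T \<gamma> \<longleftrightarrow>
     norm \<theta> = 1 \<and> flow_trajectory X Sing A \<theta> \<gamma> \<and>
     0 < T \<and> \<gamma> T = \<gamma> 0 \<and> (\<forall>t. 0 < t \<and> t < T \<longrightarrow> \<gamma> t \<noteq> \<gamma> 0)"

text \<open>The class in \<open>H\<^sub>1(X, \<int>)\<close> of the closed curve \<open>\<gamma>\<close> on \<open>{0..T}\<close>. The singular 1-simplex runs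
  from \<open>\<gamma> 0\<close> at the vertex \<open>x 1 = 0\<close> to \<open>\<gamma> T\<close> at the vertex \<open>x 1 = 1\<close>.\<close>

definition loop_class :: "'a topology \<Rightarrow> real \<Rightarrow> (real \<Rightarrow> 'a) \<Rightarrow> 'a chain set" where
  "loop_class X T \<gamma> =
     homologous_rel_set 1 X {} (frag_of (restrict (\<lambda>x. \<gamma> (T * x 1)) (standard_simplex 1)))"

text \<open>A polygon is given by the cyclic list of its vertices, in the order in which they occur on
  the boundary; consecutive edges may be collinear.\<close>

definition poly_vertex :: "complex list \<Rightarrow> nat \<Rightarrow> complex" where
  "poly_vertex vs i = vs ! (i mod length vs)"

definition poly_edge :: "complex list \<Rightarrow> nat \<Rightarrow> complex set" where
  "poly_edge vs i = closed_segment (poly_vertex vs i) (poly_vertex vs (Suc i))"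

definition poly_boundary :: "complex list \<Rightarrow> complex set" where
  "poly_boundary vs = (\<Union>i < length vs. poly_edge vs i)"

definition poly_region :: "complex list \<Rightarrow> complex set" where
  "poly_region vs = poly_boundary vs \<union> inside (poly_boundary vs)"

text \<open>The boundary is a simple closed curve, hence \<open>poly_region vs\<close> is simply connected.\<close>

definition simple_polygon :: "complex list \<Rightarrow> bool" where
  "simple_polygon vs \<longleftrightarrow>
     3 \<le> length vs \<and> distinct vs \<and>
     (\<forall>i < length vs. \<forall>j < length vs. i \<noteq> j \<longrightarrow>
        poly_edge vs i \<inter> poly_edge vs j =
          {poly_vertex vs i, poly_vertex vs (Suc i)} \<inter>
          {poly_vertex vs j, poly_vertex vs (Suc j)})"

text \<open>Edges of equal length and direction but opposite orientation have opposite edge vectors.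
  This condition does not depend on whether the list of vertices runs counterclockwise or
  clockwise.\<close>

definition edge_pairing :: "complex list \<Rightarrow> (nat \<Rightarrow> nat) \<Rightarrow> bool" where
  "edge_pairing vs \<pi> \<longleftrightarrow>
     (\<forall>i < length vs. \<pi> i < length vs \<and> \<pi> i \<noteq> i \<and> \<pi> (\<pi> i) = i \<and>
        poly_vertex vs (Suc (\<pi> i)) - poly_vertex vs (\<pi> i) =
          - (poly_vertex vs (Suc i) - poly_vertex vs i))"

text \<open>The translation from an edge to its partner takes the initial vertex of the former to the
  final vertex of the latter.\<close>

definition glue_rel :: "complex list \<Rightarrow> (nat \<Rightarrow> nat) \<Rightarrow> (complex \<times> complex) set" where
  "glue_rel vs \<pi> =
     {(z, z + (poly_vertex vs (Suc (\<pi> i)) - poly_vertex vs i)) | i z.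
        i < length vs \<and> z \<in> poly_edge vs i}"

text \<open>The surface is the quotient of the polygon by the equivalence relation that \<open>glue_rel\<close>
  generates. The last conjunct says that the flat structure comes from the polygon: \<open>q\<close> is, read in
  charts, locally a translation.\<close>

definition is_pattern ::
    "'a topology \<Rightarrow> 'a set \<Rightarrow> 'a plane_chart set \<Rightarrow> complex list \<Rightarrow> (nat \<Rightarrow> nat) \<Rightarrow> bool" where
  "is_pattern X Sing A vs \<pi> \<longleftrightarrow>
     simple_polygon vs \<and> edge_pairing vs \<pi> \<and>
     (\<exists>q. quotient_map (top_of_set (poly_region vs)) X q \<and>
          (\<forall>z \<in> poly_region vs. \<forall>w \<in> poly_region vs.
             q z = q w \<longleftrightarrow> (z, w) \<in> (glue_rel vs \<pi> \<union> (glue_rel vs \<pi>)\<inverse>)\<^sup>*) \<and>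
          Sing \<subseteq> q ` set vs \<and>
          (\<forall>(U, \<phi>) \<in> A. \<forall>z \<in> poly_region vs. q z \<in> U \<longrightarrow>
             (\<exists>c. \<exists>e > 0. \<forall>w \<in> poly_region vs \<inter> ball z e. \<phi> (q w) = w + c)))"

definition convex_translation_surface ::
    "'a topology \<Rightarrow> 'a set \<Rightarrow> 'a plane_chart set \<Rightarrow> bool" where
  "convex_translation_surface X Sing A \<longleftrightarrow>
     translation_surface X Sing A \<and>
     (\<exists>vs \<pi>. is_pattern X Sing A vs \<pi> \<and> convex (poly_region vs))"

end

theory Submission
  imports Defs
begin

text \<open>In a convex pattern the segment from the midpoint of an edge to the midpoint of its partner
  runs through the interior, because two opposite edges are never collinear; its image is a
  periodic orbit. Replacing the midpoint by another point of the edge, a vertex included, does not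
  change the homology class. Hence, modulo the subgroup generated by periodic orbits, the image of
  a segment between two identified points of the polygon vanishes, and the polygon being convex,
  so does every cycle.\<close>

section \<open>Singular 1-cycles\<close>

text \<open>The obstacle is the final step: a singular simplex of the surface need not lift to the
  polygon, since it may cross the glued edges, even infinitely often. Only its end points are
  lifted, by an arbitrary choice. After subdivision each simplex is small enough to be compared with
  images of segments inside a set without first homology. The computation takes place in subgroups
  of chains containing all boundaries, so that relations between classes become plain identities of
  chains. Opposite edges are not collinear because all edges turn in the same sense around an
  interior point, whereas partners have opposite edge vectors. This excludes partners on one
  geometrical side, where the joining segment would run along the boundary and could meet singular
  vertices. The midpoint serves only as a point of the edge that is not a vertex: singularities lie
  at vertices, and vertices are glued to vertices only.\<close>

definition subgroup_above_boundaries :: "'a topology \<Rightarrow> 'a chain set \<Rightarrow> bool" where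
  "subgroup_above_boundaries X N \<longleftrightarrow>
     (\<forall>c. singular_relboundary 1 X {} c \<longrightarrow> c \<in> N) \<and> (\<forall>c \<in> N. \<forall>d \<in> N. c - d \<in> N)"

lemma subgroup_above_boundariesD:
  assumes "subgroup_above_boundaries X N"
  shows subgroup_above_boundaries_boundary: "singular_relboundary 1 X {} c \<Longrightarrow> c \<in> N"
    and subgroup_above_boundaries_zero: "0 \<in> N"
    and subgroup_above_boundaries_diff: "c \<in> N \<Longrightarrow> d \<in> N \<Longrightarrow> c - d \<in> N"
    and subgroup_above_boundaries_minus: "c \<in> N \<Longrightarrow> - c \<in> N"
    and subgroup_above_boundaries_add: "c \<in> N \<Longrightarrow> d \<in> N \<Longrightarrow> c + d \<in> N"
proof -
  show *: "singular_relboundary 1 X {} c \<Longrightarrow> c \<in> N" for c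
    using assms unfolding subgroup_above_boundaries_def by blast
  then show zero: "0 \<in> N" by simp
  show diff: "c \<in> N \<Longrightarrow> d \<in> N \<Longrightarrow> c - d \<in> N" for c d
    using assms unfolding subgroup_above_boundaries_def by blast
  show minus: "c \<in> N \<Longrightarrow> - c \<in> N" for c
    using diff [OF zero] by simp
  show "c \<in> N \<Longrightarrow> d \<in> N \<Longrightarrow> c + d \<in> N"
    using diff [of c "- d"] minus by simp
qed

text \<open>This is the preimage of a subgroup under the projection from cycles to classes, whose
  kernel consists of the boundaries.\<close>

lemma subgroup_above_boundaries_generate:
  assumes "S \<subseteq> carrier (homology_group 1 X)"
  shows "subgroup_above_boundaries X
    {c. singular_relcycle 1 X {} c \<and> homologous_rel_set 1 X {} c \<in> generate (homology_group 1 X) S}"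
proof -
  let ?H = "homology_group 1 X"
  let ?cl = "homologous_rel_set 1 X {}"
  have grp: "group ?H" by simp
  have car: "carrier ?H = ?cl ` singular_relcycle_set 1 X {}"
    using carrier_relative_homology_group [of 1 X "{}"] by simp
  have one: "\<one>\<^bsub>?H\<^esub> = singular_relboundary_set 1 X {}"
    using one_relative_homology_group [of 1 X "{}"] by simp
  have inv: "inv\<^bsub>?H\<^esub> R = uminus ` R" if "R \<in> carrier ?H" for R
    using inv_relative_homology_group [of R 1 X "{}"] that by simp
  have mult: "R \<otimes>\<^bsub>?H\<^esub> Q = (\<Union>r\<in>R. \<Union>s\<in>Q. {r + s})" for R Q
    using mult_relative_homology_group [of 1 X "{}"] by simp
  \<comment> \<open>Classes are cosets of chains; products are sets of sums and inverses sets of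
    negatives, so two inclusions have to be checked.\<close>
  have diff: "?cl (c - d) = ?cl c \<otimes>\<^bsub>?H\<^esub> inv\<^bsub>?H\<^esub> (?cl d)"
    if "singular_relcycle 1 X {} c" "singular_relcycle 1 X {} d" for c d
  proof -
    have "?cl (c - d) \<subseteq> (\<Union>r\<in>?cl c. \<Union>s\<in>uminus ` ?cl d. {r + s})"
    proof
      fix e assume "e \<in> ?cl (c - d)"
      then have e: "homologous_rel 1 X {} (c - d) e" by simp
      have "homologous_rel 1 X {} c (e + d)"
        using homologous_rel_add [OF e homologous_rel_refl [of 1 X "{}" d]] by simp
      then have "e + d \<in> ?cl c" "- d \<in> uminus ` ?cl d" "e = (e + d) + - d"
        by auto
      then show "e \<in> (\<Union>r\<in>?cl c. \<Union>s\<in>uminus ` ?cl d. {r + s})"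
        by (metis (no_types, lifting) UN_I singletonI)
    qed
    moreover have "(\<Union>r\<in>?cl c. \<Union>s\<in>uminus ` ?cl d. {r + s}) \<subseteq> ?cl (c - d)"
      by (auto dest: homologous_rel_diff)
    ultimately show ?thesis
      using that inv [of "?cl d"] by (auto simp: car mult)
  qed
  have "c - d \<in> {c. singular_relcycle 1 X {} c \<and> ?cl c \<in> generate ?H S}"
    if "c \<in> {c. singular_relcycle 1 X {} c \<and> ?cl c \<in> generate ?H S}"
      "d \<in> {c. singular_relcycle 1 X {} c \<and> ?cl c \<in> generate ?H S}" for c d
    using that diff [of c d] group.generate_m_inv_closed [OF grp assms]
    by (auto simp: singular_relcycle_diff intro: generate.eng)
  moreover have "c \<in> {c. singular_relcycle 1 X {} c \<and> ?cl c \<in> generate ?H S}"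
    if "singular_relboundary 1 X {} c" for c
  proof -
    have "?cl c = \<one>\<^bsub>?H\<^esub>"
      using that by (simp only: one homologous_rel_set_eq_relboundary)
    then show ?thesis
      using that by (auto simp: singular_relboundary_imp_relcycle generate.one)
  qed
  ultimately show ?thesis
    unfolding subgroup_above_boundaries_def by blast
qed

section \<open>Singular simplices carried by segments and triangles\<close>

definition simplex_vertex :: "nat \<Rightarrow> nat \<Rightarrow> real" where
  "simplex_vertex i = (\<lambda>j. if j = i then 1 else 0)"

definition point_simplex :: "'a \<Rightarrow> (nat \<Rightarrow> real) \<Rightarrow> 'a" where
  "point_simplex y = restrict (\<lambda>_. y) (standard_simplex 0)"

text \<open>Barycentric coordinates make the faces of a \<open>triangle_simplex\<close> literally of
  this form; \<open>restrict\<close> gives the extensionality required of singular simplices, so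
  that such faces are equal as functions.\<close>

definition segment_simplex ::
    "('b::real_vector \<Rightarrow> 'a) \<Rightarrow> 'b \<Rightarrow> 'b \<Rightarrow> (nat \<Rightarrow> real) \<Rightarrow> 'a" where
  "segment_simplex q z w = restrict (\<lambda>x. q (x 0 *\<^sub>R z + x 1 *\<^sub>R w)) (standard_simplex 1)"

definition triangle_simplex ::
    "('b::real_vector \<Rightarrow> 'a) \<Rightarrow> 'b \<Rightarrow> 'b \<Rightarrow> 'b \<Rightarrow> (nat \<Rightarrow> real) \<Rightarrow> 'a" where
  "triangle_simplex q a b c =
     restrict (\<lambda>x. q (x 0 *\<^sub>R a + x 1 *\<^sub>R b + x 2 *\<^sub>R c)) (standard_simplex 2)"

lemma simplex_vertex_in: "i \<le> p \<Longrightarrow> simplex_vertex i \<in> standard_simplex p"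
  by (simp add: simplex_vertex_def)

lemma standard_simplex_1_iff:
  "x \<in> standard_simplex 1 \<longleftrightarrow> 0 \<le> x 0 \<and> 0 \<le> x 1 \<and> x 0 + x 1 = 1 \<and> (\<forall>i>1. x i = 0)"
proof -
  have "(\<forall>i. 0 \<le> x i \<and> x i \<le> 1)" if "0 \<le> x 0" "0 \<le> x 1" "x 0 + x 1 = 1" "\<forall>i>1. x i = 0"
  proof
    fix i :: nat
    consider "i = 0" | "i = 1" | "i > 1" by linarith
    then show "0 \<le> x i \<and> x i \<le> 1" using that by cases auto
  qed
  then show ?thesis
    by (auto simp: standard_simplex_def)
qed

lemma standard_simplex_2D:
  "x \<in> standard_simplex 2 \<Longrightarrow> 0 \<le> x 0 \<and> 0 \<le> x 1 \<and> 0 \<le> x 2 \<and> x 0 + x 1 + x 2 = 1"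
  by (simp add: standard_simplex_def numeral_2_eq_2)

lemma segment_simplex_vertex [simp]:
  "segment_simplex q z w (simplex_vertex 0) = q z"
  "segment_simplex q z w (simplex_vertex (Suc 0)) = q w"
  by (simp_all add: segment_simplex_def simplex_vertex_in) (simp_all add: simplex_vertex_def)

lemma segment_simplex_image:
  "segment_simplex q z w ` standard_simplex 1 = q ` closed_segment z w"
proof -
  have "(\<lambda>x. x 0 *\<^sub>R z + x 1 *\<^sub>R w) ` standard_simplex 1 = closed_segment z w"
  proof (intro equalityI subsetI)
    fix y assume "y \<in> (\<lambda>x. x 0 *\<^sub>R z + x 1 *\<^sub>R w) ` standard_simplex 1"
    then obtain x where x: "x \<in> standard_simplex 1" "y = x 0 *\<^sub>R z + x 1 *\<^sub>R w" by blast
    then have "x 0 = 1 - x 1" "0 \<le> x 1" "x 1 \<le> 1"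
      unfolding standard_simplex_1_iff by linarith+
    then show "y \<in> closed_segment z w"
      using x(2) unfolding closed_segment_def by force
  next
    fix y assume "y \<in> closed_segment z w"
    then obtain u where u: "0 \<le> u" "u \<le> 1" "y = (1 - u) *\<^sub>R z + u *\<^sub>R w"
      unfolding closed_segment_def by blast
    let ?x = "\<lambda>i::nat. if i = 0 then 1 - u else if i = 1 then u else 0"
    have "?x \<in> standard_simplex 1" unfolding standard_simplex_1_iff using u by auto
    moreover have "y = ?x 0 *\<^sub>R z + ?x 1 *\<^sub>R w" using u by simp
    ultimately show "y \<in> (\<lambda>x. x 0 *\<^sub>R z + x 1 *\<^sub>R w) ` standard_simplex 1"
      by (intro image_eqI [where x = ?x])
  qed
  moreover have "segment_simplex q z w ` standard_simplex 1
      = q ` (\<lambda>x. x 0 *\<^sub>R z + x 1 *\<^sub>R w) ` standard_simplex 1"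
    by (simp add: segment_simplex_def image_image)
  ultimately show ?thesis by simp
qed

lemma continuous_map_coordinate:
  "continuous_map (subtopology (powertop_real UNIV) T) euclideanreal (\<lambda>x. x i)"
  using continuous_map_product_projection [of i UNIV "\<lambda>_. euclideanreal"]
  by (simp add: continuous_map_from_subtopology)

lemma continuous_map_scaleR_left:
  fixes a :: "'b::real_normed_vector"
  assumes "continuous_map Y euclideanreal f"
  shows "continuous_map Y euclidean (\<lambda>x. f x *\<^sub>R a)"
proof -
  have "continuous_map euclideanreal euclidean (\<lambda>t. t *\<^sub>R a)"
    by (simp add: continuous_intros)
  from continuous_map_compose [OF assms this] show ?thesis
    by (simp add: comp_def)
qed

lemma singular_simplex_segment:
  fixes P :: "'b::real_normed_vector set"
  assumes q: "continuous_map (top_of_set P) X q" and sub: "closed_segment z w \<subseteq> P"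
  shows "singular_simplex 1 X (segment_simplex q z w)"
proof -
  let ?Y = "subtopology (powertop_real UNIV) (standard_simplex 1)"
  let ?f = "\<lambda>x::nat\<Rightarrow>real. x 0 *\<^sub>R z + x 1 *\<^sub>R w"
  have "continuous_map ?Y euclidean ?f"
    by (intro continuous_map_add continuous_map_scaleR_left continuous_map_coordinate)
  moreover have "?f ` standard_simplex 1 \<subseteq> P"
    using sub segment_simplex_image [of id z w] by (simp add: segment_simplex_def)
  ultimately have "continuous_map ?Y (top_of_set P) ?f"
    by (auto simp: continuous_map_in_subtopology)
  then have "continuous_map ?Y X (q \<circ> ?f)"
    using q continuous_map_compose by blast
  then show ?thesis
    unfolding singular_simplex_def segment_simplex_def
    by (auto simp: o_def intro: continuous_map_eq)
qed

lemma singular_simplex_triangle: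
  fixes P :: "'b::real_normed_vector set"
  assumes q: "continuous_map (top_of_set P) X q" and P: "convex P" "a \<in> P" "b \<in> P" "c \<in> P"
  shows "singular_simplex 2 X (triangle_simplex q a b c)"
proof -
  let ?Y = "subtopology (powertop_real UNIV) (standard_simplex 2)"
  let ?f = "\<lambda>x::nat\<Rightarrow>real. x 0 *\<^sub>R a + x 1 *\<^sub>R b + x 2 *\<^sub>R c"
  have coord: "continuous_map ?Y euclidean (\<lambda>x. x i *\<^sub>R v)" for i and v :: 'b
    by (rule continuous_map_scaleR_left [OF continuous_map_coordinate])
  have "continuous_map ?Y euclidean ?f"
    by (rule continuous_map_add [OF continuous_map_add [OF coord coord] coord])
  moreover have *: "?f x \<in> P" if "x \<in> standard_simplex 2" for x
  proof -
    have "?f x \<in> convex hull {a, b, c}"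
      unfolding convex_hull_3 mem_Collect_eq using standard_simplex_2D [OF that] 
      by (intro exI [of _ "x 0"] exI [of _ "x 1"] exI [of _ "x 2"]) simp
    also have "\<dots> \<subseteq> P"
      using P by (intro hull_minimal) auto
    finally show ?thesis .
  qed
  ultimately have "continuous_map ?Y (top_of_set P) ?f"
    unfolding continuous_map_in_subtopology by (simp add: * image_subset_iff)
  then have "continuous_map ?Y X (q \<circ> ?f)"
    using q continuous_map_compose by blast
  then show ?thesis
    unfolding singular_simplex_def triangle_simplex_def
    by (auto simp: o_def intro: continuous_map_eq)
qed

text \<open>Deleting vertex 0 leaves vertex 1, so the end point enters with the positive
  sign.\<close>

lemma chain_boundary_1_of:
  "chain_boundary 1 (frag_of f) =
     frag_of (point_simplex (f (simplex_vertex 1))) - frag_of (point_simplex (f (simplex_vertex 0)))"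
proof -
  have "simplical_face 0 (simplex_vertex 0) = simplex_vertex 1"
    "simplical_face 1 (simplex_vertex 0) = simplex_vertex 0"
    by (auto simp: fun_eq_iff simplical_face_def simplex_vertex_def)
  moreover have "standard_simplex 0 = {simplex_vertex 0}"
    by (simp add: standard_simplex_0 simplex_vertex_def)
  ultimately have "singular_face 1 0 f = point_simplex (f (simplex_vertex 1))"
    "singular_face 1 1 f = point_simplex (f (simplex_vertex 0))"
    by (auto simp: singular_face_def point_simplex_def restrict_def intro!: ext)
  then show ?thesis
    by (simp add: chain_boundary_of)
qed

lemma chain_boundary_triangle:
  "chain_boundary 2 (frag_of (triangle_simplex q a b c)) =
     frag_of (segment_simplex q b c) - frag_of (segment_simplex q a c) + frag_of (segment_simplex q a b)"
proof -
  have face: "k \<le> 2 \<Longrightarrow> x \<in> standard_simplex (Suc 0) \<Longrightarrow> simplical_face k x \<in> standard_simplex 2"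
    for k and x :: "nat \<Rightarrow> real"
    using simplical_face_in_standard_simplex [of 2 k x] by simp
  have "singular_face 2 0 (triangle_simplex q a b c) = segment_simplex q b c"
    "singular_face 2 1 (triangle_simplex q a b c) = segment_simplex q a c"
    "singular_face 2 2 (triangle_simplex q a b c) = segment_simplex q a b"
    by (auto simp: fun_eq_iff singular_face_def triangle_simplex_def segment_simplex_def face)
      (auto simp: simplical_face_def)
  then show ?thesis
    by (simp add: chain_boundary_of numeral_2_eq_2)
qed

text \<open>Modulo boundaries, images of segments add like vectors. Degenerate triangles are
  allowed, which covers constant and reversed segments as well.\<close>

lemma relboundary_triangle:
  fixes P :: "'b::real_normed_vector set"
  assumes "continuous_map (top_of_set P) X q" "convex P" "a \<in> P" "b \<in> P" "c \<in> P"
  shows "singular_relboundary 1 X {}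
    (frag_of (segment_simplex q a b) + frag_of (segment_simplex q b c) - frag_of (segment_simplex q a c))"
proof -
  have "chain_boundary (Suc 1) (frag_of (triangle_simplex q a b c)) =
    frag_of (segment_simplex q a b) + frag_of (segment_simplex q b c) - frag_of (segment_simplex q a c)"
    using chain_boundary_triangle [of q a b c] by (simp add: numeral_2_eq_2)
  moreover have "singular_chain (Suc 1) X (frag_of (triangle_simplex q a b c))"
    using singular_simplex_triangle [OF assms] by (simp add: singular_chain_of numeral_2_eq_2)
  ultimately show ?thesis
    unfolding singular_boundary by blast
qed

section \<open>Reduction of cycles to images of segments\<close>

lemma trivial_homology_cycle_imp_boundary:
  assumes "trivial_group (homology_group 1 X)" "singular_relcycle 1 X {} c"
  shows "singular_relboundary 1 X {} c"
proof -
  have "homologous_rel_set 1 X {} c \<in> carrier (homology_group 1 X)"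
    using assms(2) carrier_relative_homology_group [of 1 X "{}"] by auto
  then have "homologous_rel_set 1 X {} c = singular_relboundary_set 1 X {}"
    using assms(1) one_relative_homology_group [of 1 X "{}"] by (auto simp: trivial_group_def)
  then show ?thesis
    by (simp only: homologous_rel_set_eq_relboundary)
qed

text \<open>The open set \<open>V\<close> of the plane need not be contractible; a disc in it around
  the image of \<open>x\<close> is, and its preimage is the required neighbourhood.\<close>

lemma topological_surface_contractible_nbhd:
  assumes "topological_surface X" "x \<in> topspace X"
  obtains U where "openin X U" "x \<in> U" "contractible_space (subtopology X U)"
proof -
  obtain U V where U: "openin X U" "x \<in> U" and V: "open (V :: complex set)"
    and hom: "subtopology X U homeomorphic_space top_of_set V"
    using assms unfolding topological_surface_def by blast
  obtain f g where fg: "homeomorphic_maps (subtopology X U) (top_of_set V) f g"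
    using hom unfolding homeomorphic_space_def by blast
  have UX: "U \<subseteq> topspace X" using U openin_subset by blast
  have fx: "f x \<in> V"
    using fg U UX by (auto simp: homeomorphic_maps_def continuous_map_def Pi_iff)
  then obtain e where e: "e > 0" "ball (f x) e \<subseteq> V"
    using V open_contains_ball by blast
  have gf: "g (f y) = y" if "y \<in> U" for y
    using fg that UX by (auto simp: homeomorphic_maps_def)
  have fgy: "f (g y) = y" if "y \<in> V" for y
    using fg that by (auto simp: homeomorphic_maps_def)
  have gV: "g y \<in> U" if "y \<in> V" for y
    using fg that by (auto simp: homeomorphic_maps_def continuous_map_def Pi_iff)
  define W where "W = {y \<in> U. f y \<in> ball (f x) e}"
  have "openin (top_of_set V) (ball (f x) e)"
    using e by (simp add: openin_open_eq V)
  then have "openin (subtopology X U) {y \<in> topspace (subtopology X U). f y \<in> ball (f x) e}"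
    using fg openin_continuous_map_preimage unfolding homeomorphic_maps_def by blast
  moreover have "{y \<in> topspace (subtopology X U). f y \<in> ball (f x) e} = W"
    using UX by (auto simp: W_def)
  ultimately have W: "openin (subtopology X U) W" by simp
  have fW: "f ` W = ball (f x) e"
    using e(2) gV fgy by (force simp: W_def image_iff)
  have WU: "W \<subseteq> U" by (auto simp: W_def)
  have "homeomorphic_map (subtopology X U) (top_of_set V) f"
    using fg homeomorphic_map_maps by blast
  then have "homeomorphic_map (subtopology (subtopology X U) W) (subtopology (top_of_set V) (ball (f x) e)) f"
    by (rule homeomorphic_map_subtopologies) (use UX WU fW e(2) in \<open>simp add: Int_absorb1 Int_absorb2\<close>)
  then have "subtopology (subtopology X U) W homeomorphic_space subtopology (top_of_set V) (ball (f x) e)"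
    using homeomorphic_map_imp_homeomorphic_space by blast
  moreover have "subtopology (subtopology X U) W = subtopology X W"
    unfolding subtopology_subtopology by (rule arg_cong) (auto simp: W_def)
  moreover have "subtopology (top_of_set V) (ball (f x) e) = top_of_set (ball (f x) e)"
    unfolding subtopology_subtopology using e(2) by (simp add: Int_absorb1)
  moreover have "contractible_space (top_of_set (ball (f x) e))"
    by (simp add: contractible_space_top_of_set convex_imp_contractible)
  ultimately have "contractible_space (subtopology X W)"
    using homeomorphic_space_contractibility by metis
  moreover have "openin X W" using W U openin_trans_full by blast
  moreover have "x \<in> W" using U e by (simp add: W_def)
  ultimately show thesis using that by blast
qed

text \<open>Join a base point to every point of the surface by the image of a segment. Closing up
  a small simplex with the two joining segments gives a cycle in \<open>N\<close>, because the simplex is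
  homologous to a sum of images of segments inside a contractible neighbourhood.\<close>

lemma cycle_in_subgroup_of_convex_quotient:
  fixes P :: "'b::real_normed_vector set" and X :: "'a topology"
  assumes X: "topological_surface X"
    and P: "convex P" "compact P"
    and quot: "quotient_map (top_of_set P) X q"
    and N: "subgroup_above_boundaries X N"
    and seg: "\<And>z w. z \<in> P \<Longrightarrow> w \<in> P \<Longrightarrow> q z = q w \<Longrightarrow> frag_of (segment_simplex q z w) \<in> N"
    and c: "singular_relcycle 1 X {} c"
  shows "c \<in> N"
proof (cases "P = {}")
  case True
  then have "topspace X = {}"
    using quotient_imp_surjective_map [OF quot] by simp
  then have "c = 0"
    using c singular_chain_empty by (metis singular_cycle)
  then show ?thesis using subgroup_above_boundaries_zero [OF N] by simp
next
  case False
  then obtain p where p: "p \<in> P" by blast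
  note cont = quotient_imp_continuous_map [OF quot]
  have surj: "q ` P = topspace X"
    using quotient_imp_surjective_map [OF quot] by simp
  \<comment> \<open>Closedness will turn a neighbourhood of a whole fibre in \<open>P\<close> into a
    neighbourhood of its image point in \<open>X\<close>.\<close>
  have closed: "closed_map (top_of_set P) X q"
  proof (rule continuous_imp_closed_map [OF cont])
    show "compact_space (top_of_set P)"
      using P(2) by (simp add: compact_space_subtopology compactin_euclidean_iff)
    show "Hausdorff_space X"
      using X by (simp add: topological_surface_def)
  qed
  let ?s = "\<lambda>z w. frag_of (segment_simplex q z w)"
  \<comment> \<open>An arbitrary lift of each point, with no continuity. By \<open>base\<close>
    below, another choice changes the joining segment only by an element of
    \<open>N\<close>.\<close>
  define r where "r y = (SOME z. z \<in> P \<and> q z = y)" for y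
  have r_ex: "r y \<in> P \<and> q (r y) = y" if "y \<in> topspace X" for y
  proof -
    have "y \<in> q ` P" using that surj by simp
    then have "\<exists>z. z \<in> P \<and> q z = y" by (auto simp: image_iff)
    then show ?thesis unfolding r_def by (rule someI_ex)
  qed
  note r = conjunct1 [OF r_ex] conjunct2 [OF r_ex]
  have qP: "q z \<in> topspace X" if "z \<in> P" for z
    using surj imageI [OF that, of q] by simp
  note bd = subgroup_above_boundaries_boundary [OF N] and add = subgroup_above_boundaries_add [OF N]
    and diff = subgroup_above_boundaries_diff [OF N]
  have tri: "?s a b + ?s b d - ?s a d \<in> N" if "a \<in> P" "b \<in> P" "d \<in> P" for a b d
    using bd relboundary_triangle [OF cont P(1) that] by blast
  \<comment> \<open>In the triangle \<open>p\<close>, \<open>r (q z)\<close>, \<open>z\<close> the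
    side opposite to \<open>p\<close> joins two identified points, so it lies in \<open>N\<close> by
    \<open>seg\<close>.\<close>
  have base: "?s p (r (q z)) - ?s p z \<in> N" if "z \<in> P" for z
  proof -
    have "?s p (r (q z)) + ?s (r (q z)) z - ?s p z \<in> N"
      using tri p r qP that by blast
    moreover have "?s (r (q z)) z \<in> N"
      using seg r qP that by metis
    ultimately have "(?s p (r (q z)) + ?s (r (q z)) z - ?s p z) - ?s (r (q z)) z \<in> N"
      using diff by blast
    then show ?thesis by (simp add: algebra_simps)
  qed
  have good: "?s p (r (q z)) + ?s z w - ?s p (r (q w)) \<in> N" if "z \<in> P" "w \<in> P" for z w
    using add [OF diff [OF base [OF that(1)] base [OF that(2)]] tri [OF p that]]
    by (simp add: algebra_simps)
  \<comment> \<open>\<open>T\<close> subtracts from a chain the joining segments to the points of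
    its boundary. A single simplex becomes a closed curve through \<open>q p\<close>, while a cycle
    stays fixed.\<close>
  define T where
    "T e = e - frag_extend (\<lambda>f. ?s p (r (f (simplex_vertex 0)))) (chain_boundary 1 e)" for e
  have T_of: "T (frag_of f) =
      ?s p (r (f (simplex_vertex 0))) + frag_of f - ?s p (r (f (simplex_vertex 1)))" for f
    unfolding T_def chain_boundary_1_of
    by (simp add: frag_extend_diff point_simplex_def simplex_vertex_in)
  have T_diff: "T (a - b) = T a - T b" for a b
    by (simp add: T_def chain_boundary_diff frag_extend_diff)
  define small where "small U \<longleftrightarrow> openin X U \<and>
    (\<forall>f. singular_simplex 1 X f \<and> f ` standard_simplex 1 \<subseteq> U \<longrightarrow> T (frag_of f) \<in> N)" for U
  have "\<exists>U. small U \<and> x \<in> U" if x: "x \<in> topspace X" for x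
  proof -
    obtain V where V: "openin X V" "x \<in> V" "contractible_space (subtopology X V)"
      using topological_surface_contractible_nbhd [OF X x] by blast
    \<comment> \<open>In degree 1 reduced and ordinary homology agree, so every 1-cycle in
      \<open>V\<close> bounds.\<close>
    have V0: "singular_relboundary 1 X {} d" if "singular_relcycle 1 (subtopology X V) {} d" for d
    proof -
      have "trivial_group (homology_group 1 (subtopology X V))"
        using trivial_reduced_homology_group_contractible_space [OF V(3), of 1]
        by (simp add: un_reduced_homology_group)
      then have "singular_relboundary 1 (subtopology X V) {} d"
        using that trivial_homology_cycle_imp_boundary by blast
      then show ?thesis
        using singular_boundary_mono [where T = V and S = "topspace X"] openin_subset [OF V(1)]
          by (metis subtopology_topspace)
    qed
    \<comment> \<open>The whole fibre over \<open>x\<close> is needed: a point of \<open>P\<close>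
      mapped close to \<open>x\<close> may be close to any of the points glued together
      there.\<close>
    define F where "F = {z \<in> P. q z = x}"
    have pre: "openin (top_of_set P) {z \<in> P. q z \<in> V}"
      using openin_continuous_map_preimage [OF cont V(1)] by simp
    have "\<exists>e>0. ball z e \<inter> P \<subseteq> {z \<in> P. q z \<in> V}" if "z \<in> F" for z
    proof -
      have "z \<in> {z \<in> P. q z \<in> V}" using that V by (simp add: F_def)
      then show ?thesis
        using pre unfolding openin_contains_ball by blast
    qed
    then obtain e where e: "\<And>z. z \<in> F \<Longrightarrow> e z > 0"
      "\<And>z. z \<in> F \<Longrightarrow> ball z (e z) \<inter> P \<subseteq> {z \<in> P. q z \<in> V}"
      by metis
    define W where "W = P \<inter> (\<Union>z\<in>F. ball z (e z))"
    have "openin (top_of_set P) W"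
      unfolding W_def by (simp add: openin_open_Int open_UN)
    \<comment> \<open>Removing the image of \<open>P - W\<close> leaves an open set all of whose
      preimages lie in \<open>W\<close>.\<close>
    then have "closedin (top_of_set P) (P - W)"
      by (metis closedin_diff closedin_topspace topspace_euclidean_subtopology)
    then have "closedin X (q ` (P - W))"
      using closed closed_map_def by blast
    then have U: "openin X (topspace X - q ` (P - W))"
      by blast
    define U where "U = topspace X - q ` (P - W)"
    have "x \<in> U"
      using x e(1) by (force simp: U_def W_def F_def)
    \<comment> \<open>A preimage of \<open>y\<close> lies in one of the balls around the fibre; ball
      and \<open>P\<close> are convex, so the segment from the centre stays in both.\<close>
    have near: "\<exists>z0 \<in> F. \<exists>z \<in> P. q z = y \<and> q ` closed_segment z0 z \<subseteq> V" if "y \<in> U" for y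
    proof -
      have y: "y \<in> topspace X" "y \<notin> q ` (P - W)" using that by (simp_all add: U_def)
      obtain z where z: "z \<in> P" "q z = y" using r [OF y(1)] by metis
      then have "z \<in> W" using y(2) by blast
      then obtain z0 where z0: "z0 \<in> F" "z \<in> ball z0 (e z0)" by (auto simp: W_def)
      have "closed_segment z0 z \<subseteq> ball z0 (e z0) \<inter> P"
      proof (rule closed_segment_subset)
        show "convex (ball z0 (e z0) \<inter> P)" using P by (simp add: convex_Int)
      qed (use z z0 e(1) in \<open>auto simp: F_def\<close>)
      then show ?thesis
        using z z0 e(2) by blast
    qed
    have "T (frag_of f) \<in> N" if f: "singular_simplex 1 X f" "f ` standard_simplex 1 \<subseteq> U" for f
    proof -
      define a where "a = f (simplex_vertex 0)"
      define b where "b = f (simplex_vertex 1)"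
      have ab: "a \<in> U" "b \<in> U"
        using f(2) simplex_vertex_in [of 0 1] simplex_vertex_in [of 1 1] by (auto simp: a_def b_def)
      obtain z0 z where z: "z0 \<in> F" "z \<in> P" "q z = a" "q ` closed_segment z0 z \<subseteq> V"
        using near [OF ab(1)] by blast
      obtain w0 w where w: "w0 \<in> F" "w \<in> P" "q w = b" "q ` closed_segment w0 w \<subseteq> V"
        using near [OF ab(2)] by blast
      have F: "z0 \<in> P" "w0 \<in> P" "q z0 = x" "q w0 = x" using z w by (auto simp: F_def)
      have "U \<subseteq> V"
        using near by (metis (no_types, lifting) ends_in_segment(2) image_subset_iff subsetI)
      then have "singular_simplex 1 (subtopology X V) f"
        using f by (auto simp: singular_simplex_subtopology)
      moreover have "closed_segment z0 z \<subseteq> P" "closed_segment w0 w \<subseteq> P"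
        using closed_segment_subset [OF _ _ P(1)] F z w by simp_all
      then have "singular_simplex 1 (subtopology X V) (segment_simplex q z0 z)"
        "singular_simplex 1 (subtopology X V) (segment_simplex q w0 w)"
        using z(4) w(4) singular_simplex_segment [OF cont]
        by (simp_all only: singular_simplex_subtopology segment_simplex_image)
      \<comment> \<open>The closed curve runs from \<open>x\<close> to \<open>a\<close>, along
        \<open>f\<close> to \<open>b\<close>, and back to \<open>x\<close>. The lifts
        \<open>z0\<close> and \<open>w0\<close> may differ, but both map to
        \<open>x\<close>.\<close>
      ultimately have "singular_chain 1 (subtopology X V) (?s z0 z + frag_of f - ?s w0 w)"
        by (intro singular_chain_diff singular_chain_add) (simp_all add: singular_chain_of)
      moreover have "chain_boundary 1 (?s z0 z + frag_of f - ?s w0 w) = 0"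
        unfolding chain_boundary_diff chain_boundary_add chain_boundary_1_of
        using z w F by (simp add: a_def b_def)
      ultimately have "singular_relcycle 1 (subtopology X V) {} (?s z0 z + frag_of f - ?s w0 w)"
        by (simp add: singular_cycle)
      then have "?s z0 z + frag_of f - ?s w0 w \<in> N"
        using V0 bd by blast
      moreover have "?s p (r x) + ?s z0 z - ?s p (r a) \<in> N" "?s p (r x) + ?s w0 w - ?s p (r b) \<in> N"
        using good [OF F(1) z(2)] good [OF F(2) w(2)] F z w by auto
      \<comment> \<open>The joining segments over \<open>x\<close> and the two short segments
        cancel, and \<open>T (frag_of f)\<close> remains.\<close>
      ultimately have "(?s z0 z + frag_of f - ?s w0 w) - (?s p (r x) + ?s z0 z - ?s p (r a))
          + (?s p (r x) + ?s w0 w - ?s p (r b)) \<in> N"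
        using add diff by blast
      then show ?thesis
        unfolding T_of a_def [symmetric] b_def [symmetric] by (simp add: algebra_simps)
    qed
    then have "small U"
      using U by (simp add: small_def U_def)
    then show ?thesis using \<open>x \<in> U\<close> by blast
  qed
  then have "topspace X \<subseteq> \<Union> (Collect small)"
    by blast
  moreover have "openin X U" if "U \<in> Collect small" for U
    using that by (simp add: small_def)
  \<comment> \<open>Iterated barycentric subdivision: \<open>c\<close> is replaced by a homologous
    cycle whose simplices each lie in one member of the cover.\<close>
  ultimately obtain d where d: "singular_relcycle 1 X {} d" "homologous_rel 1 X {} c d"
    "\<And>f. f \<in> Poly_Mapping.keys d \<Longrightarrow> \<exists>V \<in> Collect small. f \<in> standard_simplex 1 \<rightarrow> V"
    using small_homologous_rel_relcycle_exists [of "Collect small" X 1 "{}" c] c by metis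
  let ?K = "{f. singular_simplex 1 X f \<and> (\<exists>V \<in> Collect small. f ` standard_simplex 1 \<subseteq> V)}"
  have "Poly_Mapping.keys d \<subseteq> ?K"
  proof
    fix f assume f: "f \<in> Poly_Mapping.keys d"
    then obtain V where "V \<in> Collect small" "f \<in> standard_simplex 1 \<rightarrow> V" using d(3) by blast
    moreover have "singular_simplex 1 X f"
      using d(1) f unfolding singular_cycle singular_chain_def by blast
    ultimately show "f \<in> ?K" by blast
  qed
  then have "T d \<in> N"
  proof (induction d rule: frag_induction)
    case zero
    then show ?case
      using subgroup_above_boundaries_zero [OF N] by (simp add: T_def)
  next
    case (one f)
    then show ?case by (auto simp: small_def)
  next
    case (diff a b)
    then show ?case
      using subgroup_above_boundaries_diff [OF N] by (simp add: T_diff)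
  qed
  moreover have "T d = d"
    using d(1) by (simp add: T_def singular_cycle)
  moreover have "c - d \<in> N"
    using d(2) bd by (simp add: homologous_rel_def)
  ultimately show ?thesis
    using add [of "c - d" d] by simp
qed

section \<open>Convex polygons\<close>

lemma poly_vertex_mod: "i mod length vs = j mod length vs \<Longrightarrow> poly_vertex vs i = poly_vertex vs j"
  by (simp add: poly_vertex_def)

lemma poly_edge_mod: "poly_edge vs (i mod length vs) = poly_edge vs i"
  unfolding poly_edge_def
  by (intro arg_cong2 [where f = closed_segment] poly_vertex_mod) (simp_all add: mod_Suc_eq)

lemma poly_vertex_eq_iff:
  assumes "simple_polygon vs"
  shows "poly_vertex vs i = poly_vertex vs j \<longleftrightarrow> i mod length vs = j mod length vs"
proof -
  have "length vs > 0" "distinct vs" using assms by (auto simp: simple_polygon_def)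
  then show ?thesis
    unfolding poly_vertex_def by (simp add: nth_eq_iff_index_eq)
qed

lemma poly_vertex_Suc_neq:
  assumes "simple_polygon vs"
  shows "poly_vertex vs (Suc i) \<noteq> poly_vertex vs i"
proof -
  have "length vs \<ge> 3" using assms by (simp add: simple_polygon_def)
  then have "Suc i mod length vs \<noteq> i mod length vs"
    by (auto simp: mod_Suc)
  then show ?thesis by (simp add: poly_vertex_eq_iff [OF assms])
qed

lemma poly_edge_inter:
  assumes "simple_polygon vs" "i mod length vs \<noteq> j mod length vs"
  shows "poly_edge vs i \<inter> poly_edge vs j =
    {poly_vertex vs i, poly_vertex vs (Suc i)} \<inter> {poly_vertex vs j, poly_vertex vs (Suc j)}"
proof -
  have n: "length vs > 0" using assms by (auto simp: simple_polygon_def)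
  let ?m = "\<lambda>i. i mod length vs"
  have "poly_edge vs (?m i) \<inter> poly_edge vs (?m j) =
    {poly_vertex vs (?m i), poly_vertex vs (Suc (?m i))} \<inter> {poly_vertex vs (?m j), poly_vertex vs (Suc (?m j))}"
    using assms n unfolding simple_polygon_def by simp
  moreover have "poly_vertex vs (?m i) = poly_vertex vs i" "poly_vertex vs (Suc (?m i)) = poly_vertex vs (Suc i)" for i
    by (auto intro!: poly_vertex_mod simp: mod_Suc_eq)
  ultimately show ?thesis
    by (simp only: poly_edge_mod)
qed

text \<open>A vertex lies on the edge that starts at it, and distinct edges meet only in common end
  points; so no edge contains a vertex in its relative interior, even where sides are
  subdivided.\<close>

lemma poly_vertex_in_edge_iff:
  assumes "simple_polygon vs"
  shows "poly_vertex vs k \<in> poly_edge vs i \<longleftrightarrow>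
    poly_vertex vs k = poly_vertex vs i \<or> poly_vertex vs k = poly_vertex vs (Suc i)"
proof (cases "k mod length vs = i mod length vs")
  case True
  then show ?thesis
    by (simp add: poly_vertex_eq_iff [OF assms] poly_edge_def poly_vertex_mod [OF True])
next
  case False
  have "poly_vertex vs k \<in> poly_edge vs k" by (simp add: poly_edge_def)
  then show ?thesis
    using poly_edge_inter [OF assms False] by (auto simp: poly_edge_def)
qed

section \<open>The boundary as a Jordan curve\<close>

lemma set_eq_poly_vertex: "set vs = {poly_vertex vs i | i. i < length vs}"
  unfolding poly_vertex_def set_conv_nth by (intro Collect_cong) (metis mod_less)

lemma poly_vertex_in_set:
  assumes "simple_polygon vs" shows "poly_vertex vs i \<in> set vs"
proof -
  have "length vs > 0" using assms by (auto simp: simple_polygon_def)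
  then show ?thesis by (simp add: poly_vertex_def)
qed

lemma poly_edge_subset_boundary:
  assumes "simple_polygon vs" shows "poly_edge vs i \<subseteq> poly_boundary vs"
proof -
  have "length vs > 0" using assms by (auto simp: simple_polygon_def)
  then have "i mod length vs < length vs" by simp
  then have "poly_edge vs (i mod length vs) \<subseteq> poly_boundary vs"
    unfolding poly_boundary_def by blast
  then show ?thesis by (simp only: poly_edge_mod)
qed

lemma polygonal_arc:
  assumes vs: "simple_polygon vs" and k: "0 < k" "k < length vs"
  shows "\<exists>g. arc g \<and> path_image g = (\<Union>i<k. poly_edge vs i) \<and>
    pathstart g = poly_vertex vs 0 \<and> pathfinish g = poly_vertex vs k"
  using k
proof (induction k)
  case 0
  then show ?case by simp
next
  case (Suc k)
  have lp: "arc (linepath (poly_vertex vs k) (poly_vertex vs (Suc k)))"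
    using poly_vertex_Suc_neq [OF vs, of k] by simp
  show ?case
  proof (cases "k = 0")
    case True
    then show ?thesis
      using lp
      by (intro exI [of _ "linepath (poly_vertex vs k) (poly_vertex vs (Suc k))"]) (simp add: poly_edge_def lessThan_Suc)
  next
    case False
    then obtain g where g: "arc g" "path_image g = (\<Union>i<k. poly_edge vs i)"
      "pathstart g = poly_vertex vs 0" "pathfinish g = poly_vertex vs k"
      using Suc by auto
    let ?l = "linepath (poly_vertex vs k) (poly_vertex vs (Suc k))"
    have "path_image g \<inter> path_image ?l \<subseteq> {pathstart ?l}"
    proof
      fix x assume "x \<in> path_image g \<inter> path_image ?l"
      then obtain i where i: "i < k" "x \<in> poly_edge vs i" "x \<in> poly_edge vs k"
        by (auto simp: g poly_edge_def)
      have neq: "i mod length vs \<noteq> k mod length vs" using i Suc.prems by simp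
      have "x \<in> {poly_vertex vs i, poly_vertex vs (Suc i)} \<inter> {poly_vertex vs k, poly_vertex vs (Suc k)}"
        using poly_edge_inter [OF vs neq] i(2,3) by blast
      moreover have "poly_vertex vs (Suc k) \<noteq> poly_vertex vs i" "poly_vertex vs (Suc k) \<noteq> poly_vertex vs (Suc i)"
        using i Suc.prems by (simp_all add: poly_vertex_eq_iff [OF vs])
      ultimately show "x \<in> {pathstart ?l}" by auto
    qed
    then have "arc (g +++ ?l)"
      using g lp by (intro arc_join) auto
    moreover have "path_image (g +++ ?l) = (\<Union>i<Suc k. poly_edge vs i)"
      using g by (simp add: path_image_join lessThan_Suc poly_edge_def Un_commute)
    ultimately show ?thesis
      using g by (intro exI [of _ "g +++ ?l"]) simp
  qed
qed

text \<open>All edges but the last form an arc; the last one closes it and meets it exactly in the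
  two end points.\<close>

lemma poly_boundary_simple_path:
  assumes vs: "simple_polygon vs"
  obtains c where "simple_path c" "pathfinish c = pathstart c" "path_image c = poly_boundary vs"
proof -
  have n: "length vs \<ge> 3" using vs by (simp add: simple_polygon_def)
  define k where "k = length vs - 1"
  have k: "0 < k" "k < length vs" "length vs = Suc k" using n by (auto simp: k_def)
  obtain g where g: "arc g" "path_image g = (\<Union>i<k. poly_edge vs i)"
      "pathstart g = poly_vertex vs 0" "pathfinish g = poly_vertex vs k"
    using polygonal_arc [OF vs k(1,2)] by blast
  let ?l = "linepath (poly_vertex vs k) (poly_vertex vs (Suc k))"
  have last: "poly_vertex vs (Suc k) = poly_vertex vs 0"
    by (rule poly_vertex_mod) (simp add: k(3))
  have "path_image g \<inter> path_image ?l \<subseteq> {pathstart g, pathstart ?l}"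
  proof
    fix x assume "x \<in> path_image g \<inter> path_image ?l"
    then obtain i where i: "i < k" "x \<in> poly_edge vs i" "x \<in> poly_edge vs k"
      by (auto simp: g poly_edge_def)
    have neq: "i mod length vs \<noteq> k mod length vs" using i k by simp
    show "x \<in> {pathstart g, pathstart ?l}"
      using poly_edge_inter [OF vs neq] i(2,3) g last by auto
  qed
  moreover have "arc ?l" using poly_vertex_Suc_neq [OF vs, of k] by simp
  ultimately have "simple_path (g +++ ?l)"
    using g last by (intro simple_path_join_loop) auto
  moreover have "path_image (g +++ ?l) = poly_boundary vs"
    using g by (simp add: path_image_join poly_boundary_def k(3) lessThan_Suc poly_edge_def Un_commute)
  ultimately show thesis
    using that [of "g +++ ?l"] g last by simp
qed

lemma poly_region_topology:
  assumes vs: "simple_polygon vs"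
  shows compact_poly_region: "compact (poly_region vs)"
    and frontier_poly_region: "frontier (poly_region vs) = poly_boundary vs"
    and interior_poly_region_nonempty: "interior (poly_region vs) \<noteq> {}"
proof -
  obtain c where c: "simple_path c" "pathfinish c = pathstart c" "path_image c = poly_boundary vs"
    using poly_boundary_simple_path [OF vs] .
  let ?B = "poly_boundary vs"
  have J: "inside ?B \<noteq> {}" "open (inside ?B)" "open (outside ?B)" "bounded (inside ?B)"
    "frontier (outside ?B) = ?B"
    using Jordan_inside_outside [OF c(1,2)] unfolding c(3) by blast+
  \<comment> \<open>As the complement of the outside component, the region inherits closedness and
    its frontier from the Jordan curve theorem.\<close>
  have P: "poly_region vs = - outside ?B"
    unfolding poly_region_def using union_with_inside by blast
  have "compact ?B"
    using c compact_simple_path_image by metis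
  then have "bounded (poly_region vs)"
    using J(4) by (simp add: poly_region_def compact_imp_bounded)
  then show "compact (poly_region vs)"
    using J(3) by (simp add: P compact_eq_bounded_closed closed_Compl)
  show "frontier (poly_region vs) = ?B"
    by (simp add: P frontier_complement J)
  show "interior (poly_region vs) \<noteq> {}"
    using J(1) interior_maximal [OF _ J(2), of "poly_region vs"] by (auto simp: poly_region_def)
qed

section \<open>Determinants and the orientation of edges\<close>

definition cross_prod :: "complex \<Rightarrow> complex \<Rightarrow> real" where
  "cross_prod z w = Re z * Im w - Im z * Re w"

lemma cross_prod_simps:
  "cross_prod (a + b) c = cross_prod a c + cross_prod b c"
  "cross_prod a (b + c) = cross_prod a b + cross_prod a c"
  "cross_prod (a - b) c = cross_prod a c - cross_prod b c"
  "cross_prod a (b - c) = cross_prod a b - cross_prod a c"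
  "cross_prod (- a) b = - cross_prod a b"
  "cross_prod a (- b) = - cross_prod a b"
  "cross_prod (t *\<^sub>R a) b = t * cross_prod a b"
  "cross_prod a (t *\<^sub>R b) = t * cross_prod a b"
  "cross_prod a a = 0"
  by (simp_all add: cross_prod_def algebra_simps)

lemma cross_prod_swap: "cross_prod a b = - cross_prod b a"
  by (simp add: cross_prod_def)

lemma cross_prod_eq_0_imp_scaleR:
  assumes "cross_prod a b = 0" "a \<noteq> 0"
  obtains t where "b = t *\<^sub>R a"
proof
  \<comment> \<open>The coefficient of the orthogonal projection of \<open>b\<close> onto the line
    of \<open>a\<close>.\<close>
  let ?t = "(Re a * Re b + Im a * Im b) / (Re a ^ 2 + Im a ^ 2)"
  have pos: "Re a ^ 2 + Im a ^ 2 \<noteq> 0"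
    using assms(2) by (simp add: complex_eq_iff sum_power2_eq_zero_iff)
  have eq: "Re a * Im b = Im a * Re b" using assms(1) by (simp add: cross_prod_def)
  have "(Re a * Re b + Im a * Im b) * Re a = Re b * (Re a ^ 2 + Im a ^ 2)"
    "(Re a * Re b + Im a * Im b) * Im a = Im b * (Re a ^ 2 + Im a ^ 2)"
  proof -
    have "(Re a * Re b + Im a * Im b) * Re a
        = Re b * (Re a ^ 2 + Im a ^ 2) + Im a * (Re a * Im b - Im a * Re b)"
      "(Re a * Re b + Im a * Im b) * Im a
        = Im b * (Re a ^ 2 + Im a ^ 2) - Re a * (Re a * Im b - Im a * Re b)"
      by (simp_all add: power2_eq_square algebra_simps)
    then show "(Re a * Re b + Im a * Im b) * Re a = Re b * (Re a ^ 2 + Im a ^ 2)"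
      "(Re a * Re b + Im a * Im b) * Im a = Im b * (Re a ^ 2 + Im a ^ 2)"
      using eq by simp_all
  qed
  then show "b = ?t *\<^sub>R a"
    using pos by (simp add: complex_eq_iff field_simps)
qed

text \<open>Of two frontier points on a ray, the nearer would lie on the open segment from an
  interior point to a point of the closure, hence in the interior.\<close>

lemma frontier_point_on_ray_unique:
  fixes P :: "complex set"
  assumes P: "convex P" "closed P" and p: "p \<in> interior P"
    and x: "x \<in> frontier P" and y: "y \<in> frontier P" and s: "s > 0" "y - p = s *\<^sub>R (x - p)"
  shows "x = y"
proof -
  have less: False if "u \<in> frontier P" "v \<in> frontier P" "0 < t" "t < 1" "u - p = t *\<^sub>R (v - p)" for u v t
  proof -
    have "v \<in> closure P" "u \<notin> interior P" "v \<notin> interior P"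
      using that by (auto simp: frontier_def)
    then have "open_segment p v \<subseteq> interior P"
      using in_interior_closure_convex_segment P p by blast
    moreover have "u = (1 - t) *\<^sub>R p + t *\<^sub>R v"
      using that(5) by (simp add: algebra_simps)
    then have "u \<in> open_segment p v"
      using that p \<open>v \<notin> interior P\<close> by (auto simp: in_segment)
    ultimately show False using \<open>u \<notin> interior P\<close> by blast
  qed
  consider "s < 1" | "s = 1" | "s > 1" by linarith
  then show ?thesis
  proof cases
    case 1
    then show ?thesis using less [OF y x s(1) _ s(2)] by blast
  next
    case 2
    then show ?thesis using s by simp
  next
    case 3
    have "x - p = (1 / s) *\<^sub>R (y - p)" using s by simp
    then show ?thesis using less [OF x y, of "1 / s"] 3 by auto
  qed
qed

text \<open>Seen from an interior point, all the edges of a convex polygon are traversed in the same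
  sense: otherwise two consecutive edges would overlap angularly, and a ray would meet both.\<close>

lemma convex_polygon_edge_signs:
  assumes vs: "simple_polygon vs" and conv: "convex (poly_region vs)"
    and p: "p \<in> interior (poly_region vs)"
  shows "0 < cross_prod (poly_vertex vs i - p) (poly_vertex vs (Suc i) - p) *
             cross_prod (poly_vertex vs j - p) (poly_vertex vs (Suc j) - p)"
proof -
  let ?P = "poly_region vs"
  define a where "a i = poly_vertex vs i - p" for i
  \<comment> \<open>Twice the signed area of the triangle formed by \<open>p\<close> and edge
    \<open>i\<close>.\<close>
  define s where "s i = cross_prod (a i) (a (Suc i))" for i
  have closed: "closed ?P" using compact_poly_region [OF vs] compact_imp_closed by blast
  have pB: "p \<notin> poly_boundary vs"
    using p frontier_poly_region [OF vs] by (auto simp: frontier_def)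
  have unique: "x = y" if "x + p \<in> poly_boundary vs" "y + p \<in> poly_boundary vs" "t > 0" "y = t *\<^sub>R x" for x y t
    using frontier_point_on_ray_unique [OF conv closed p, of "x + p" "y + p" t] that
      frontier_poly_region [OF vs] by simp
  have edgeB: "a i + u *\<^sub>R (a (Suc i) - a i) + p \<in> poly_edge vs i" if "0 \<le> u" "u \<le> 1" for i u
  proof -
    have "a i + u *\<^sub>R (a (Suc i) - a i) + p = (1 - u) *\<^sub>R poly_vertex vs i + u *\<^sub>R poly_vertex vs (Suc i)"
      by (simp add: a_def algebra_simps)
    then show ?thesis using that by (auto simp: poly_edge_def in_segment)
  qed
  have vB: "a i + p \<in> poly_boundary vs" for i
    using edgeB [of 0 i] poly_edge_subset_boundary [OF vs] by auto
  have a0: "a i \<noteq> 0" for i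
    using vB [of i] pB by auto
  have aneq: "a (Suc i) \<noteq> a i" for i
    using poly_vertex_Suc_neq [OF vs] by (simp add: a_def)
  \<comment> \<open>A degenerate triangle has both vertices on one ray from \<open>p\<close>,
    against \<open>unique\<close>, or on opposite rays, and then the edge contains \<open>p\<close>;
    no vertex equals \<open>p\<close>.\<close>
  have s0: "s i \<noteq> 0" for i
  proof
    assume "s i = 0"
    then obtain t where t: "a (Suc i) = t *\<^sub>R a i"
      using cross_prod_eq_0_imp_scaleR a0 s_def by metis
    consider "t > 0" | "t = 0" | "t < 0" by linarith
    then show False
    proof cases
      case 1
      then show False using unique [OF vB [of i] vB [of "Suc i"] 1 t] aneq [of i] by simp
    next
      case 2
      then show False using t a0 by simp
    next
      case 3
      \<comment> \<open>The parameter at which the edge passes through \<open>p\<close>, that is,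
        the root of \<open>1 - u + u * t\<close>.\<close>
      let ?u = "1 / (1 - t)"
      have "1 - ?u + ?u * t = 0" using 3 by (simp add: field_simps)
      moreover have "a i + ?u *\<^sub>R (a (Suc i) - a i) = (1 - ?u + ?u * t) *\<^sub>R a i"
        by (simp add: t algebra_simps)
      ultimately have "p \<in> poly_edge vs i"
        using edgeB [of ?u i] 3 by simp
      then show False using pB poly_edge_subset_boundary [OF vs] by blast
    qed
  qed
  have step: "0 < s i * s (Suc i)" for i
  proof (rule ccontr)
    assume "\<not> ?thesis"
    then have neg: "s i * s (Suc i) < 0"
      using s0 [of i] s0 [of "Suc i"] by (simp add: not_less order_le_less)
    define v where "v = a (Suc i)"
    define x where "x = a i - v"
    define y where "y = a (Suc (Suc i)) - v"
    \<comment> \<open>With opposite signs of \<open>s\<close>, the numbers \<open>\<alpha>\<close>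
      and \<open>\<beta>\<close> have equal sign: both edges leave \<open>v\<close> towards the same
      side of the ray from \<open>p\<close>. The determinant of \<open>v + e *\<^sub>R x\<close> and
      \<open>v + d *\<^sub>R y\<close> is \<open>e * (\<alpha> + d * K) - d * \<beta>\<close>, which
      explains the quotient below as the solution for \<open>e\<close>.\<close>
    define \<alpha> where "\<alpha> = s i"
    define \<beta> where "\<beta> = - s (Suc i)"
    define K where "K = cross_prod x y"
    have c1: "cross_prod x v = \<alpha>" and c2: "cross_prod v y = - \<beta>"
      by (simp_all add: x_def y_def \<alpha>_def \<beta>_def s_def v_def cross_prod_simps)
    have ab: "\<alpha> * \<beta> > 0" using neg by (simp add: \<alpha>_def \<beta>_def)
    have "((\<lambda>d. d * \<beta> / (\<alpha> + d * K)) \<longlongrightarrow> 0 * \<beta> / (\<alpha> + 0 * K)) (at_right 0)"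
      by (intro tendsto_intros) (use ab in auto)
    moreover have "((\<lambda>d. (v + d *\<^sub>R y) \<bullet> (v + (d * \<beta> / (\<alpha> + d * K)) *\<^sub>R x)) \<longlongrightarrow>
        (v + 0 *\<^sub>R y) \<bullet> (v + (0 * \<beta> / (\<alpha> + 0 * K)) *\<^sub>R x)) (at_right 0)"
      by (intro tendsto_intros) (use ab in auto)
    moreover have "((\<lambda>d. (\<alpha> + d * K) * \<beta>) \<longlongrightarrow> (\<alpha> + 0 * K) * \<beta>) (at_right 0)"
      by (intro tendsto_intros)
    moreover have "v \<bullet> v > 0" using a0 by (simp add: v_def)
    \<comment> \<open>For small \<open>d\<close> the solution \<open>e\<close> is positive and below
      1, and the two points are near \<open>v\<close>, so their inner product is positive: they lie
      on the same ray, not on opposite ones.\<close>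
    ultimately have ev: "\<forall>\<^sub>F d in at_right 0. (\<alpha> + d * K) * \<beta> > 0"
      "\<forall>\<^sub>F d in at_right 0. d * \<beta> / (\<alpha> + d * K) < 1"
      "\<forall>\<^sub>F d in at_right 0. (v + d *\<^sub>R y) \<bullet> (v + (d * \<beta> / (\<alpha> + d * K)) *\<^sub>R x) > 0"
      using ab by (auto intro: order_tendstoD)
    have ev0: "\<forall>\<^sub>F d in at_right (0::real). 0 < d \<and> d < 1"
      by (intro eventually_conj eventually_at_right_less eventually_at_right_real [THEN eventually_mono]) auto
    have "\<forall>\<^sub>F d in at_right 0. (0 < d \<and> d < 1) \<and> (\<alpha> + d * K) * \<beta> > 0 \<and>
        d * \<beta> / (\<alpha> + d * K) < 1 \<and> (v + d *\<^sub>R y) \<bullet> (v + (d * \<beta> / (\<alpha> + d * K)) *\<^sub>R x) > 0"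
      by (rule eventually_conj [OF ev0 eventually_conj [OF ev(1) eventually_conj [OF ev(2,3)]]])
    then obtain d where d: "0 < d" "d < 1" "(\<alpha> + d * K) * \<beta> > 0"
        "d * \<beta> / (\<alpha> + d * K) < 1" "(v + d *\<^sub>R y) \<bullet> (v + (d * \<beta> / (\<alpha> + d * K)) *\<^sub>R x) > 0"
      using eventually_happens' [OF trivial_limit_at_right_real] by blast
    define e where "e = d * \<beta> / (\<alpha> + d * K)"
    have e: "0 < e" "e < 1"
      using d by (auto simp: e_def zero_less_mult_iff zero_less_divide_iff mult_less_0_iff)
    define f where "f = v + e *\<^sub>R x"
    define g where "g = v + d *\<^sub>R y"
    have "e * (\<alpha> + d * K) = d * \<beta>" using d by (auto simp: e_def)
    then have "cross_prod f g = 0"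
      by (simp add: f_def g_def cross_prod_simps c1 c2 K_def [symmetric] algebra_simps)
    have "g \<bullet> f > 0" using d(5) by (simp add: f_def g_def e_def)
    then have "f \<noteq> 0" by auto
    then obtain t where t: "g = t *\<^sub>R f"
      using \<open>cross_prod f g = 0\<close> cross_prod_eq_0_imp_scaleR by blast
    have "t > 0"
      using \<open>g \<bullet> f > 0\<close> t inner_ge_zero [of f] by (auto simp: zero_less_mult_iff)
    have "f = a i + (1 - e) *\<^sub>R (a (Suc i) - a i)"
      by (simp add: f_def x_def v_def algebra_simps)
    then have fE: "f + p \<in> poly_edge vs i"
      using edgeB [of "1 - e" i] e by simp
    have gE: "g + p \<in> poly_edge vs (Suc i)"
      using edgeB [of d "Suc i"] d by (simp add: g_def y_def v_def)
    have "f = g"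
      using unique fE gE poly_edge_subset_boundary [OF vs] \<open>t > 0\<close> t by blast
    have n: "length vs \<ge> 3" using vs by (simp add: simple_polygon_def)
    have ne: "i mod length vs \<noteq> Suc i mod length vs"
      using n by (auto simp: mod_Suc)
    \<comment> \<open>With at least three vertices, consecutive edges share only the vertex between
      them, which forces \<open>f = v\<close>.\<close>
    have ne2: "i mod length vs \<noteq> Suc (Suc i) mod length vs"
      using n by (auto simp: mod_Suc)
    have "f + p \<in> {poly_vertex vs i, poly_vertex vs (Suc i)} \<inter> {poly_vertex vs (Suc i), poly_vertex vs (Suc (Suc i))}"
      using poly_edge_inter [OF vs ne] fE gE \<open>f = g\<close> by blast
    then have "f + p = poly_vertex vs (Suc i)"
      using ne2 ne poly_vertex_eq_iff [OF vs] by auto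
    then have "f = v" by (simp add: v_def a_def algebra_simps)
    then have "x = 0" using e by (simp add: f_def)
    then show False using aneq [of i] by (simp add: x_def v_def)
  qed
  have "0 < s 0 * s i" for i
  proof (induction i)
    case 0
    then show ?case using s0 [of 0] by (simp add: zero_less_mult_iff linorder_neq_iff) linarith
  next
    case (Suc i)
    then show ?case using step [of i] by (auto simp: zero_less_mult_iff)
  qed
  from this [of i] this [of j] have "0 < s i * s j"
    by (auto simp: zero_less_mult_iff)
  then show ?thesis by (simp add: s_def a_def)
qed

lemma opposite_edges_not_collinear:
  assumes vs: "simple_polygon vs" and conv: "convex (poly_region vs)"
    and opp: "poly_vertex vs (Suc j) - poly_vertex vs j = - (poly_vertex vs (Suc i) - poly_vertex vs i)"
  shows "cross_prod (poly_vertex vs (Suc i) - poly_vertex vs i) (poly_vertex vs (Suc j) - poly_vertex vs i) \<noteq> 0"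
proof
  let ?V = "poly_vertex vs"
  assume 0: "cross_prod (?V (Suc i) - ?V i) (?V (Suc j) - ?V i) = 0"
  obtain p where p: "p \<in> interior (poly_region vs)"
    using interior_poly_region_nonempty [OF vs] by blast
  define u where "u = ?V (Suc i) - ?V i"
  define \<tau> where "\<tau> = ?V (Suc j) - ?V i"
  define b where "b = ?V i - p"
  have eq: "?V (Suc i) - p = b + u" "?V (Suc j) - p = b + \<tau>" "?V j - p = b + \<tau> + u"
    using opp by (simp_all add: u_def \<tau>_def b_def algebra_simps)
  have u\<tau>: "cross_prod u \<tau> = 0" using 0 by (simp add: u_def \<tau>_def)
  have "cross_prod (?V i - p) (?V (Suc i) - p) = cross_prod b u"
    \<comment> \<open>If \<open>\<tau>\<close> is parallel to \<open>u\<close>, shifting an edge by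
      \<open>\<tau>\<close> keeps its signed area; reversing the edge changes the sign, against the
      common sign of all edges.\<close>
    "cross_prod (?V j - p) (?V (Suc j) - p) = - cross_prod b u"
    unfolding eq using cross_prod_swap [of b u] cross_prod_swap [of \<tau> u] cross_prod_swap [of \<tau> b] u\<tau>
    by (simp_all add: b_def [symmetric] cross_prod_simps)
  then have "0 < cross_prod b u * - cross_prod b u"
    using convex_polygon_edge_signs [OF vs conv p, of i j] by simp
  then show False
    by (simp add: not_less [symmetric] zero_less_mult_iff)
qed

text \<open>The point lies in the open parallelogram spanned by two opposite edges, which is
  nondegenerate.\<close>

lemma opposite_edges_segment_interior:
  assumes vs: "simple_polygon vs" and conv: "convex (poly_region vs)"
    and opp: "poly_vertex vs (Suc j) - poly_vertex vs j = - (poly_vertex vs (Suc i) - poly_vertex vs i)"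
    and s: "0 < s" "s < 1" and t: "0 < t" "t < 1"
  shows "poly_vertex vs i + s *\<^sub>R (poly_vertex vs (Suc i) - poly_vertex vs i) +
    t *\<^sub>R (poly_vertex vs (Suc j) - poly_vertex vs i) \<in> interior (poly_region vs)"
proof -
  let ?V = "poly_vertex vs"
  let ?P = "poly_region vs"
  define u where "u = ?V (Suc i) - ?V i"
  define \<tau> where "\<tau> = ?V (Suc j) - ?V i"
  define D where "D = cross_prod u \<tau>"
  have D: "D \<noteq> 0"
    using opposite_edges_not_collinear [OF vs conv opp] by (simp add: D_def u_def \<tau>_def)
  \<comment> \<open>Cramer's rule: \<open>\<sigma> w\<close> and \<open>\<rho> w\<close> are the
    coordinates of \<open>w - ?V i\<close> in the basis \<open>u\<close>,
    \<open>\<tau>\<close>.\<close>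
  define \<sigma> where "\<sigma> w = cross_prod (w - ?V i) \<tau> / D" for w
  define \<rho> where "\<rho> w = cross_prod u (w - ?V i) / D" for w
  define S where "S = {w. 0 < \<sigma> w \<and> \<sigma> w < 1 \<and> 0 < \<rho> w \<and> \<rho> w < 1}"
  have "continuous_on UNIV \<sigma>" "continuous_on UNIV \<rho>"
    unfolding \<sigma>_def \<rho>_def cross_prod_def using D by (auto intro!: continuous_intros)
  then have "open S"
    unfolding S_def by (intro open_Collect_conj open_Collect_less) (auto intro: continuous_intros)
  have V: "?V k \<in> ?P" for k
  proof -
    have "?V k \<in> poly_edge vs k" by (simp add: poly_edge_def)
    then show ?thesis using poly_edge_subset_boundary [OF vs] by (auto simp: poly_region_def)
  qed
  have "S \<subseteq> ?P"
  proof
    fix w assume w: "w \<in> S"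
    have "D *\<^sub>R (w - ?V i) = cross_prod (w - ?V i) \<tau> *\<^sub>R u + cross_prod u (w - ?V i) *\<^sub>R \<tau>"
      by (simp add: D_def cross_prod_def complex_eq_iff algebra_simps)
    also have "\<dots> = D *\<^sub>R (\<sigma> w *\<^sub>R u + \<rho> w *\<^sub>R \<tau>)"
      using D by (simp add: \<sigma>_def \<rho>_def scaleR_right_distrib)
    finally have "w - ?V i = \<sigma> w *\<^sub>R u + \<rho> w *\<^sub>R \<tau>"
      using D by simp
    then have "w = (1 - \<rho> w) *\<^sub>R ((1 - \<sigma> w) *\<^sub>R ?V i + \<sigma> w *\<^sub>R (?V i + u)) +
        \<rho> w *\<^sub>R ((1 - \<sigma> w) *\<^sub>R (?V i + \<tau>) + \<sigma> w *\<^sub>R (?V i + \<tau> + u))"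
      by (simp add: algebra_simps)
    moreover have "?V i + u = ?V (Suc i)" "?V i + \<tau> = ?V (Suc j)" "?V i + \<tau> + u = ?V j"
      using opp by (simp_all add: u_def \<tau>_def algebra_simps)
    ultimately have "w = (1 - \<rho> w) *\<^sub>R ((1 - \<sigma> w) *\<^sub>R ?V i + \<sigma> w *\<^sub>R ?V (Suc i)) +
        \<rho> w *\<^sub>R ((1 - \<sigma> w) *\<^sub>R ?V (Suc j) + \<sigma> w *\<^sub>R ?V j)"
      by simp
    moreover have "\<dots> \<in> ?P"
      using w V by (intro convexD [OF conv]) (auto simp: S_def)
    ultimately show "w \<in> ?P" by simp
  qed
  moreover have "?V i + s *\<^sub>R u + t *\<^sub>R \<tau> \<in> S"
  proof -
    have "cross_prod (s *\<^sub>R u + t *\<^sub>R \<tau>) \<tau> = s * D" "cross_prod u (s *\<^sub>R u + t *\<^sub>R \<tau>) = t * D"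
      by (simp_all add: D_def cross_prod_simps)
    then have "\<sigma> (?V i + s *\<^sub>R u + t *\<^sub>R \<tau>) = s" "\<rho> (?V i + s *\<^sub>R u + t *\<^sub>R \<tau>) = t"
      using D by (simp_all add: \<sigma>_def \<rho>_def add.assoc)
    then show ?thesis using s t by (simp add: S_def)
  qed
  ultimately show ?thesis
    using interior_maximal [OF _ \<open>open S\<close>] by (auto simp: u_def \<tau>_def)
qed

section \<open>Periodic orbits\<close>

text \<open>Near time \<open>t\<close> the orbit is the image of a segment ending in \<open>b\<close> followed by one starting in \<open>a\<close>;
  the two points differ exactly when the orbit crosses the identified edges.\<close>

lemma frac_orbit_local:
  fixes P :: "complex set"
  assumes P: "convex P" "z \<in> P" "z + \<tau> \<in> P" and \<tau>: "\<tau> \<noteq> 0" and q: "q (z + \<tau>) = q z"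
  defines "T \<equiv> norm \<tau>"
  defines "\<gamma> \<equiv> \<lambda>t. q (z + frac (t / T) *\<^sub>R \<tau>)"
  obtains e a b where "e > 0" "a \<in> P" "b \<in> P" "q a = \<gamma> t" "q b = \<gamma> t"
    "\<And>h. 0 \<le> h \<Longrightarrow> h < e \<Longrightarrow> a + of_real h * (\<tau> / of_real T) \<in> P \<and> \<gamma> (t + h) = q (a + of_real h * (\<tau> / of_real T))"
    "\<And>h. - e < h \<Longrightarrow> h \<le> 0 \<Longrightarrow> b + of_real h * (\<tau> / of_real T) \<in> P \<and> \<gamma> (t + h) = q (b + of_real h * (\<tau> / of_real T))"
proof -
  have T: "T > 0" using \<tau> by (simp add: T_def)
  define f where "f = frac (t / T)"
  have f: "0 \<le> f" "f < 1" by (simp_all add: f_def frac_lt_1)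
  have inP: "z + r *\<^sub>R \<tau> \<in> P" if "0 \<le> r" "r \<le> 1" for r
  proof -
    have "(1 - r) *\<^sub>R z + r *\<^sub>R (z + \<tau>) \<in> P"
      using that P by (intro convexD) auto
    then show ?thesis by (simp add: algebra_simps)
  qed
  have shift: "z + r *\<^sub>R \<tau> + of_real h * (\<tau> / of_real T) = z + (r + h / T) *\<^sub>R \<tau>" for r h
    by (simp add: scaleR_conv_of_real field_simps)
  \<comment> \<open>\<open>k\<close> is 0 as long as the orbit stays in the same period, and -1 just
    before the start of a period.\<close>
  have frac_shift: "frac ((t + h) / T) = f + h / T - of_int k"
    if "0 \<le> f + h / T - of_int k" "f + h / T - of_int k < 1" for h and k :: int
  proof -
    have "(t + h) / T - (f + h / T - of_int k) = of_int (\<lfloor>t / T\<rfloor> + k)"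
      by (simp add: f_def frac_def add_divide_distrib)
    then show ?thesis
      using that unfolding frac_unique_iff by (metis Ints_of_int)
  qed
  have \<gamma>t: "\<gamma> t = q (z + f *\<^sub>R \<tau>)" by (simp add: \<gamma>_def f_def)
  have right: "z + f *\<^sub>R \<tau> + of_real h * (\<tau> / of_real T) \<in> P \<and>
      \<gamma> (t + h) = q (z + f *\<^sub>R \<tau> + of_real h * (\<tau> / of_real T))"
    if "0 \<le> h" "h < T * (1 - f)" for h
  proof -
    have "h / T < 1 - f" "0 \<le> h / T" using that T by (auto simp: field_simps)
    then show ?thesis
      using f frac_shift [of h 0] inP [of "f + h / T"] unfolding shift \<gamma>_def by simp
  qed
  show thesis
  proof (cases "f = 0")
    case False
    have left: "z + f *\<^sub>R \<tau> + of_real h * (\<tau> / of_real T) \<in> P \<and>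
        \<gamma> (t + h) = q (z + f *\<^sub>R \<tau> + of_real h * (\<tau> / of_real T))"
      if "- (T * f) < h" "h \<le> 0" for h
    proof -
      have "- f < h / T" "h / T \<le> 0" using that T by (auto simp: field_simps)
      then show ?thesis
        using f frac_shift [of h 0] inP [of "f + h / T"] unfolding shift \<gamma>_def by simp
    qed
    show thesis
    proof (rule that [of "min (T * (1 - f)) (T * f)" "z + f *\<^sub>R \<tau>" "z + f *\<^sub>R \<tau>"])
      show "0 < min (T * (1 - f)) (T * f)" using T f False by simp
    qed (use inP f \<gamma>t left right in auto)
  next
    case True
    have left: "z + \<tau> + of_real h * (\<tau> / of_real T) \<in> P \<and>
        \<gamma> (t + h) = q (z + \<tau> + of_real h * (\<tau> / of_real T))"
      if h: "- T < h" "h \<le> 0" for h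
    \<comment> \<open>At \<open>h = 0\<close> the fractional part is 0 and not 1, so the formula
      rests on the identification of \<open>z\<close> with \<open>z + \<tau>\<close>.\<close>
    proof (cases "h = 0")
      case True
      then show ?thesis using P q \<gamma>t \<open>f = 0\<close> by simp
    next
      case False
      then have "- 1 < h / T" "h / T < 0" using h T by (auto simp: field_simps)
      then show ?thesis
        using True frac_shift [of h "- 1"] inP [of "1 + h / T"]
        unfolding shift [of 1 h, unfolded scaleR_one] \<gamma>_def by (simp add: add.commute)
    qed
    show thesis
    proof (rule that [of T z "z + \<tau>"])
      show "T > 0" by (rule T)
    qed (use P q T \<gamma>t True left right in auto)
  qed
qed

text \<open>The plane curve under \<open>q\<close> jumps at every multiple of \<open>T\<close>.
  Continuity and the chart equation survive because they are checked separately to the left and to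
  the right of each time, and the gluing makes both sides agree there.\<close>

lemma frac_orbit_flow_trajectory:
  fixes P :: "complex set"
  assumes P: "convex P" "z \<in> P" "z + \<tau> \<in> P" and \<tau>: "\<tau> \<noteq> 0" and qz: "q (z + \<tau>) = q z"
    and q: "continuous_map (top_of_set P) X q"
    and charts: "\<forall>(U, \<phi>) \<in> A. \<forall>z \<in> P. q z \<in> U \<longrightarrow>
             (\<exists>c. \<exists>e > 0. \<forall>w \<in> P \<inter> ball z e. \<phi> (q w) = w + c)"
    and Sing: "\<And>r. 0 \<le> r \<Longrightarrow> r < 1 \<Longrightarrow> q (z + r *\<^sub>R \<tau>) \<notin> Sing"
  defines "T \<equiv> norm \<tau>"
  shows "flow_trajectory X Sing A (\<tau> / of_real T) (\<lambda>t. q (z + frac (t / T) *\<^sub>R \<tau>))"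
proof -
  let ?\<gamma> = "\<lambda>t. q (z + frac (t / T) *\<^sub>R \<tau>)"
  let ?\<theta> = "\<tau> / of_real T"
  have norm_\<theta>: "norm ?\<theta> = 1" using \<tau> by (simp add: T_def norm_divide)
  have n: "dist c (c + of_real h * ?\<theta>) = \<bar>h\<bar>" for c h
  proof -
    have "dist c (c + of_real h * ?\<theta>) = norm (of_real h * ?\<theta>)" by (simp add: dist_norm)
    also have "\<dots> = \<bar>h\<bar>" unfolding norm_mult norm_\<theta> by simp
    finally show ?thesis .
  qed
  note local = frac_orbit_local [OF P \<tau> qz, folded T_def]
  have reg: "?\<gamma> t \<in> topspace X - Sing" for t
  proof -
    have "(1 - frac (t / T)) *\<^sub>R z + frac (t / T) *\<^sub>R (z + \<tau>) \<in> P"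
      using P by (intro convexD) (auto simp: less_imp_le [OF frac_lt_1])
    then have "z + frac (t / T) *\<^sub>R \<tau> \<in> P" by (simp add: algebra_simps)
    then have "?\<gamma> t \<in> topspace X"
      using q by (auto simp: continuous_map_def)
    then show ?thesis using Sing [of "frac (t / T)"] frac_lt_1 by auto
  qed
  have "continuous_map euclideanreal X ?\<gamma>"
    unfolding continuous_map_def
  proof (intro conjI allI impI)
    show "?\<gamma> \<in> topspace euclideanreal \<rightarrow> topspace X" using reg by auto
    fix U assume U: "openin X U"
    have pre: "openin (top_of_set P) {w \<in> P. q w \<in> U}"
      using openin_continuous_map_preimage [OF q U] by simp
    have "open {t. ?\<gamma> t \<in> U}"
      unfolding open_dist
    proof
      fix t assume t: "t \<in> {t. ?\<gamma> t \<in> U}"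
      obtain e a b where e: "e > 0" and ab: "a \<in> P" "b \<in> P" "q a = ?\<gamma> t" "q b = ?\<gamma> t"
        and right: "\<And>h. 0 \<le> h \<Longrightarrow> h < e \<Longrightarrow> a + of_real h * ?\<theta> \<in> P \<and> ?\<gamma> (t + h) = q (a + of_real h * ?\<theta>)"
        and left: "\<And>h. - e < h \<Longrightarrow> h \<le> 0 \<Longrightarrow> b + of_real h * ?\<theta> \<in> P \<and> ?\<gamma> (t + h) = q (b + of_real h * ?\<theta>)"
        using local [of t] by blast
      have "a \<in> {w \<in> P. q w \<in> U}" "b \<in> {w \<in> P. q w \<in> U}" using ab t by auto
      \<comment> \<open>\<open>a\<close> and \<open>b\<close> may lie on different edges, so each
        side of \<open>t\<close> needs its own ball.\<close>
      then obtain da db where d: "da > 0" "ball a da \<inter> P \<subseteq> {w \<in> P. q w \<in> U}"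
        "db > 0" "ball b db \<inter> P \<subseteq> {w \<in> P. q w \<in> U}"
        using pre unfolding openin_contains_ball by meson
      show "\<exists>e>0. \<forall>y. dist y t < e \<longrightarrow> y \<in> {t. ?\<gamma> t \<in> U}"
      proof (intro exI conjI allI impI)
        show "min e (min da db) > 0" using e d by simp
        fix y assume y: "dist y t < min e (min da db)"
        define h where "h = y - t"
        have h: "\<bar>h\<bar> < e" "\<bar>h\<bar> < da" "\<bar>h\<bar> < db" "y = t + h" using y by (auto simp: h_def dist_real_def)
        show "y \<in> {t. ?\<gamma> t \<in> U}"
        proof (cases "0 \<le> h")
          case True
          then have "a + of_real h * ?\<theta> \<in> ball a da \<inter> P" "?\<gamma> y = q (a + of_real h * ?\<theta>)"
            using right [of h] h n [of a h] by auto
          then show ?thesis using d(2) by auto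
        next
          case False
          then have "b + of_real h * ?\<theta> \<in> ball b db \<inter> P" "?\<gamma> y = q (b + of_real h * ?\<theta>)"
            using left [of h] h n [of b h] by auto
          then show ?thesis using d(4) by auto
        qed
      qed
    qed
    then show "openin euclideanreal {t \<in> topspace euclideanreal. ?\<gamma> t \<in> U}" by simp
  qed
  then have "continuous_map euclideanreal (regular_part X Sing) ?\<gamma>"
    using reg by (auto simp: continuous_map_in_subtopology)
  moreover have "\<phi> (?\<gamma> t2) = \<phi> (?\<gamma> t1) + of_real (t2 - t1) * ?\<theta>"
    if U: "(U, \<phi>) \<in> A" and t: "t1 \<le> t2" "?\<gamma> ` {t1..t2} \<subseteq> U" for U \<phi> t1 t2
  proof -
    \<comment> \<open>The chart reading with the uniform motion removed: locally constant, hence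
      constant on the connected interval.\<close>
    define H where "H t = \<phi> (?\<gamma> t) - of_real t * ?\<theta>" for t
    have "H t1 = H t2"
    proof (rule connected_local_const [of "{t1..t2}"])
      show "\<forall>t\<in>{t1..t2}. \<forall>\<^sub>F s in at t within {t1..t2}. H t = H s"
      proof
        fix t assume "t \<in> {t1..t2}"
        then have t: "?\<gamma> t \<in> U" using t by blast
        obtain e a b where e: "e > 0" and ab: "a \<in> P" "b \<in> P" "q a = ?\<gamma> t" "q b = ?\<gamma> t"
          and right: "\<And>h. 0 \<le> h \<Longrightarrow> h < e \<Longrightarrow> a + of_real h * ?\<theta> \<in> P \<and> ?\<gamma> (t + h) = q (a + of_real h * ?\<theta>)"
          and left: "\<And>h. - e < h \<Longrightarrow> h \<le> 0 \<Longrightarrow> b + of_real h * ?\<theta> \<in> P \<and> ?\<gamma> (t + h) = q (b + of_real h * ?\<theta>)"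
          using local [of t] by blast
        have chart: "\<exists>c. \<exists>e > 0. \<forall>w \<in> P \<inter> ball z e. \<phi> (q w) = w + c" if "z \<in> P" "q z \<in> U" for z
          using charts U that by blast
        obtain ca da where da: "da > 0" "\<And>w. w \<in> P \<inter> ball a da \<Longrightarrow> \<phi> (q w) = w + ca"
          using chart [OF ab(1)] ab(3) t by metis
        obtain cb db where db: "db > 0" "\<And>w. w \<in> P \<inter> ball b db \<Longrightarrow> \<phi> (q w) = w + cb"
          using chart [OF ab(2)] ab(4) t by metis
        \<comment> \<open>The local translation constants \<open>ca\<close> and \<open>cb\<close>
          may differ, but both describe the same chart value at time \<open>t\<close>.\<close>
        have base: "\<phi> (?\<gamma> t) = a + ca" "\<phi> (?\<gamma> t) = b + cb"
          using da(2) [of a] db(2) [of b] ab da(1) db(1) by auto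
        have "H t = H s" if s: "dist s t < min e (min da db)" for s
        proof -
          define h where "h = s - t"
          have h: "\<bar>h\<bar> < e" "\<bar>h\<bar> < da" "\<bar>h\<bar> < db" "s = t + h" using s by (auto simp: h_def dist_real_def)
          have "\<phi> (?\<gamma> (t + h)) = \<phi> (?\<gamma> t) + of_real h * ?\<theta>"
          proof (cases "0 \<le> h")
            case True
            then have "a + of_real h * ?\<theta> \<in> P \<inter> ball a da" "?\<gamma> (t + h) = q (a + of_real h * ?\<theta>)"
              using right [of h] h n [of a h] by auto
            then show ?thesis using da(2) base(1) by (metis add.commute add.left_commute)
          next
            case False
            then have "b + of_real h * ?\<theta> \<in> P \<inter> ball b db" "?\<gamma> (t + h) = q (b + of_real h * ?\<theta>)"
              using left [of h] h n [of b h] by auto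
            then show ?thesis using db(2) base(2) by (metis add.commute add.left_commute)
          qed
          then show ?thesis unfolding H_def h(4) of_real_add distrib_right by simp
        qed
        moreover have "min e (min da db) > 0" using e da db by simp
        ultimately show "\<forall>\<^sub>F s in at t within {t1..t2}. H t = H s"
          unfolding eventually_at by blast
      qed
    qed (use t in auto)
    then show ?thesis unfolding H_def of_real_diff left_diff_distrib by (simp add: algebra_simps)
  qed
  ultimately show ?thesis
    unfolding flow_trajectory_def by blast
qed

lemma frac_orbit_loop_class:
  assumes \<tau>: "(\<tau> :: complex) \<noteq> 0" and qz: "q (z + \<tau>) = q z"
  shows "loop_class X (norm \<tau>) (\<lambda>t. q (z + frac (t / norm \<tau>) *\<^sub>R \<tau>)) =
    homologous_rel_set 1 X {} (frag_of (segment_simplex q z (z + \<tau>)))"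
proof -
  have "q (z + frac (norm \<tau> * x 1 / norm \<tau>) *\<^sub>R \<tau>) = q (x 0 *\<^sub>R z + x 1 *\<^sub>R (z + \<tau>))"
    if x: "x \<in> standard_simplex 1" for x
  proof -
    have x01: "x 0 = 1 - x 1" "0 \<le> x 1" "x 1 \<le> 1"
      using x unfolding standard_simplex_1_iff by linarith+
    have seg: "x 0 *\<^sub>R z + x 1 *\<^sub>R (z + \<tau>) = z + x 1 *\<^sub>R \<tau>"
      unfolding x01(1) by (simp add: algebra_simps)
    show ?thesis
    \<comment> \<open>At the final vertex \<open>frac\<close> drops to 0, which \<open>qz\<close>
      absorbs; the two simplices are therefore equal, not merely homologous.\<close>
    proof (cases "x 1 = 1")
      case True
      then show ?thesis unfolding seg using qz \<tau> by simp
    next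
      case False
      then have "frac (x 1) = x 1" using x01 by (simp add: frac_eq)
      then show ?thesis unfolding seg using \<tau> by simp
    qed
  qed
  then have "restrict (\<lambda>x. q (z + frac (norm \<tau> * x 1 / norm \<tau>) *\<^sub>R \<tau>)) (standard_simplex 1) =
      segment_simplex q z (z + \<tau>)"
    unfolding segment_simplex_def by (rule restrict_ext)
  then show ?thesis by (simp only: loop_class_def)
qed

lemma loop_class_in_homology_group:
  assumes "periodic_orbit X Sing A \<theta> T \<gamma>"
  shows "loop_class X T \<gamma> \<in> carrier (homology_group 1 X)"
proof -
  have T: "\<gamma> T = \<gamma> 0" and "continuous_map euclideanreal (regular_part X Sing) \<gamma>"
    using assms by (auto simp: periodic_orbit_def flow_trajectory_def)
  then have \<gamma>: "continuous_map euclideanreal X \<gamma>"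
    by (simp add: continuous_map_in_subtopology)
  let ?s = "restrict (\<lambda>x. \<gamma> (T * x 1)) (standard_simplex 1)"
  have "continuous_map (subtopology (powertop_real UNIV) (standard_simplex 1)) euclideanreal (\<lambda>x. T * x 1)"
    by (intro continuous_map_real_mult_left continuous_map_coordinate)
  from continuous_map_compose [OF this \<gamma>]
  have "singular_simplex 1 X ?s"
    unfolding singular_simplex_def by (auto simp: o_def intro: continuous_map_eq)
  moreover have "?s (simplex_vertex 1) = \<gamma> T" "?s (simplex_vertex 0) = \<gamma> 0"
    using simplex_vertex_in [of 0 1] simplex_vertex_in [of 1 1] by (simp_all add: simplex_vertex_def)
  then have "chain_boundary 1 (frag_of ?s) = 0"
    by (simp only: chain_boundary_1_of T) simp
  ultimately have "singular_relcycle 1 X {} (frag_of ?s)"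
    by (simp add: singular_cycle singular_chain_of)
  then show ?thesis
    using carrier_relative_homology_group [of 1 X "{}"] unfolding loop_class_def by auto
qed

section \<open>Gluing\<close>

text \<open>The partner edge is traversed backwards, so the parameter \<open>s\<close> becomes
  \<open>1 - s\<close>.\<close>

lemma glue_edge_point:
  assumes "edge_pairing vs \<pi>" "i < length vs"
  shows "poly_vertex vs i + s *\<^sub>R (poly_vertex vs (Suc i) - poly_vertex vs i) +
      (poly_vertex vs (Suc (\<pi> i)) - poly_vertex vs i) =
    poly_vertex vs (\<pi> i) + (1 - s) *\<^sub>R (poly_vertex vs (Suc (\<pi> i)) - poly_vertex vs (\<pi> i))"
proof -
  have "poly_vertex vs (Suc (\<pi> i)) - poly_vertex vs (\<pi> i) = - (poly_vertex vs (Suc i) - poly_vertex vs i)"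
    using assms unfolding edge_pairing_def by blast
  then have e: "poly_vertex vs (Suc (\<pi> i)) = poly_vertex vs (\<pi> i) - (poly_vertex vs (Suc i) - poly_vertex vs i)"
    by (simp add: algebra_simps)
  show ?thesis unfolding e by (simp add: algebra_simps)
qed

lemma poly_edge_iff:
  "x \<in> poly_edge vs i \<longleftrightarrow>
    (\<exists>s. 0 \<le> s \<and> s \<le> 1 \<and> x = poly_vertex vs i + s *\<^sub>R (poly_vertex vs (Suc i) - poly_vertex vs i))"
  unfolding poly_edge_def in_segment by (simp add: algebra_simps)

lemma poly_edge_vertex_iff:
  assumes "simple_polygon vs" "0 \<le> s" "s \<le> 1"
  shows "poly_vertex vs i + s *\<^sub>R (poly_vertex vs (Suc i) - poly_vertex vs i) \<in> set vs \<longleftrightarrow> s = 0 \<or> s = 1"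
proof -
  let ?x = "poly_vertex vs i + s *\<^sub>R (poly_vertex vs (Suc i) - poly_vertex vs i)"
  have x: "?x \<in> poly_edge vs i" unfolding poly_edge_iff using assms by blast
  have neq: "poly_vertex vs (Suc i) - poly_vertex vs i \<noteq> 0"
    using poly_vertex_Suc_neq [OF assms(1)] by simp
  show ?thesis
  proof
    assume "?x \<in> set vs"
    then obtain k where "?x = poly_vertex vs k" by (auto simp: set_eq_poly_vertex)
    then have "?x = poly_vertex vs i \<or> ?x = poly_vertex vs (Suc i)"
      using x poly_vertex_in_edge_iff [OF assms(1)] by simp
    then show "s = 0 \<or> s = 1"
    proof
      assume "?x = poly_vertex vs i"
      then show ?thesis using neq by simp
    next
      assume x1: "?x = poly_vertex vs (Suc i)"
      have "(1 - s) *\<^sub>R (poly_vertex vs (Suc i) - poly_vertex vs i) = poly_vertex vs (Suc i) - ?x"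
        by (simp add: algebra_simps)
      also have "\<dots> = 0" unfolding x1 by simp
      finally show ?thesis using neq by simp
    qed
  next
    assume "s = 0 \<or> s = 1"
    then show "?x \<in> set vs" using poly_vertex_in_set [OF assms(1)] by auto
  qed
qed

lemma glue_rel_boundary:
  assumes vs: "simple_polygon vs" and \<pi>: "edge_pairing vs \<pi>" and xy: "(x, y) \<in> glue_rel vs \<pi>"
  shows "x \<in> poly_boundary vs" "y \<in> poly_boundary vs" "x \<in> set vs \<longleftrightarrow> y \<in> set vs"
proof -
  obtain i where i: "i < length vs" "x \<in> poly_edge vs i"
    "y = x + (poly_vertex vs (Suc (\<pi> i)) - poly_vertex vs i)"
    using xy unfolding glue_rel_def by blast
  obtain s where s: "0 \<le> s" "s \<le> 1" "x = poly_vertex vs i + s *\<^sub>R (poly_vertex vs (Suc i) - poly_vertex vs i)"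
    using i(2) unfolding poly_edge_iff by blast
  have y: "y = poly_vertex vs (\<pi> i) + (1 - s) *\<^sub>R (poly_vertex vs (Suc (\<pi> i)) - poly_vertex vs (\<pi> i))"
    using glue_edge_point [OF \<pi> i(1), of s] i(3) s(3) by simp
  then have "y \<in> poly_edge vs (\<pi> i)"
    unfolding poly_edge_iff using s by (intro exI [of _ "1 - s"]) simp
  then show "x \<in> poly_boundary vs" "y \<in> poly_boundary vs"
    using i(2) poly_edge_subset_boundary [OF vs] by blast+
  show "x \<in> set vs \<longleftrightarrow> y \<in> set vs"
    unfolding s(3) using poly_edge_vertex_iff [OF vs, of s i] poly_edge_vertex_iff [OF vs, of "1 - s" "\<pi> i"] s y
    by auto
qed

text \<open>Both properties pass along a single gluing and hence along chains of gluings. The first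
  yields the least period of the orbits, the second keeps them off the singularities.\<close>

lemma glue_equivalence:
  assumes vs: "simple_polygon vs" and \<pi>: "edge_pairing vs \<pi>"
    and xy: "(x, y) \<in> (glue_rel vs \<pi> \<union> (glue_rel vs \<pi>)\<inverse>)\<^sup>*"
  shows "x = y \<or> x \<in> poly_boundary vs \<and> y \<in> poly_boundary vs" "x \<in> set vs \<longleftrightarrow> y \<in> set vs"
proof -
  have "(x = y \<or> x \<in> poly_boundary vs \<and> y \<in> poly_boundary vs) \<and> (x \<in> set vs \<longleftrightarrow> y \<in> set vs)"
    using xy
  proof (induction rule: rtrancl_induct)
    case base
    then show ?case by simp
  next
    case (step y w)
    then show ?case
      using glue_rel_boundary [OF vs \<pi>, of y w] glue_rel_boundary [OF vs \<pi>, of w y] by blast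
  qed
  then show "x = y \<or> x \<in> poly_boundary vs \<and> y \<in> poly_boundary vs" "x \<in> set vs \<longleftrightarrow> y \<in> set vs"
    by blast+
qed

lemma edge_midpoint_periodic_orbit:
  assumes vs: "simple_polygon vs" and \<pi>: "edge_pairing vs \<pi>" and conv: "convex (poly_region vs)"
    and q: "continuous_map (top_of_set (poly_region vs)) X q"
    and glue: "\<forall>z \<in> poly_region vs. \<forall>w \<in> poly_region vs.
             q z = q w \<longleftrightarrow> (z, w) \<in> (glue_rel vs \<pi> \<union> (glue_rel vs \<pi>)\<inverse>)\<^sup>*"
    and Sing: "Sing \<subseteq> q ` set vs"
    and charts: "\<forall>(U, \<phi>) \<in> A. \<forall>z \<in> poly_region vs. q z \<in> U \<longrightarrow>
             (\<exists>c. \<exists>e > 0. \<forall>w \<in> poly_region vs \<inter> ball z e. \<phi> (q w) = w + c)"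
    and i: "i < length vs"
  defines "m \<equiv> poly_vertex vs i + (1/2) *\<^sub>R (poly_vertex vs (Suc i) - poly_vertex vs i)"
    and "\<tau> \<equiv> poly_vertex vs (Suc (\<pi> i)) - poly_vertex vs i"
  shows "\<exists>\<theta> T \<gamma>. periodic_orbit X Sing A \<theta> T \<gamma> \<and>
    loop_class X T \<gamma> = homologous_rel_set 1 X {} (frag_of (segment_simplex q m (m + \<tau>)))"
proof -
  let ?P = "poly_region vs"
  let ?B = "poly_boundary vs"
  have BP: "?B \<subseteq> ?P" by (simp add: poly_region_def)
  have opp: "poly_vertex vs (Suc (\<pi> i)) - poly_vertex vs (\<pi> i) = - (poly_vertex vs (Suc i) - poly_vertex vs i)"
    using \<pi> i unfolding edge_pairing_def by blast
  \<comment> \<open>A zero translation would make the determinant with the edge vector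
    vanish.\<close>
  have \<tau>: "\<tau> \<noteq> 0"
    using opposite_edges_not_collinear [OF vs conv opp] by (auto simp: \<tau>_def cross_prod_def)
  have mE: "m \<in> poly_edge vs i"
    unfolding poly_edge_iff m_def by (intro exI [of _ "1/2"]) simp
  then have mg: "(m, m + \<tau>) \<in> glue_rel vs \<pi>"
    unfolding glue_rel_def \<tau>_def using i by blast
  have mB: "m \<in> ?B" "m + \<tau> \<in> ?B"
    using glue_rel_boundary [OF vs \<pi> mg] by blast+
  have mv: "m \<notin> set vs"
    unfolding m_def using poly_edge_vertex_iff [OF vs, of "1/2" i] by simp
  have qm: "q (m + \<tau>) = q m"
    using glue mg mB BP by (metis UnCI r_into_rtrancl subsetD)
  have int: "m + r *\<^sub>R \<tau> \<in> interior ?P" if "0 < r" "r < 1" for r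
    using opposite_edges_segment_interior [OF vs conv opp, of "1/2" r] that by (simp add: m_def \<tau>_def)
  have intB: "w \<notin> ?B" if "w \<in> interior ?P" for w
    using that frontier_poly_region [OF vs] by (auto simp: frontier_def)
  have vB: "v \<in> ?B" if v: "v \<in> set vs" for v
  proof -
    obtain k where "v = poly_vertex vs k" using v by (auto simp: set_eq_poly_vertex)
    then have "v \<in> poly_edge vs k" by (simp add: poly_edge_def)
    then show ?thesis using poly_edge_subset_boundary [OF vs] by blast
  qed
  have nonsing: "q w \<notin> Sing" if "w \<in> ?P" "w \<notin> set vs" for w
  proof
    assume "q w \<in> Sing"
    then obtain v where v: "v \<in> set vs" "q w = q v" using Sing by blast
    then have "(w, v) \<in> (glue_rel vs \<pi> \<union> (glue_rel vs \<pi>)\<inverse>)\<^sup>*"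
      using glue that vB BP by blast
    then show False
      using glue_equivalence(2) [OF vs \<pi>] v that by blast
  qed
  have line: "m + r *\<^sub>R \<tau> \<in> ?P \<and> m + r *\<^sub>R \<tau> \<notin> set vs" if "0 \<le> r" "r < 1" for r
  proof (cases "r = 0")
    case True
    then show ?thesis using mB BP mv by auto
  next
    case False
    then have "m + r *\<^sub>R \<tau> \<in> interior ?P" using int that by simp
    then show ?thesis using intB vB interior_subset by blast
  qed
  let ?\<gamma> = "\<lambda>t. q (m + frac (t / norm \<tau>) *\<^sub>R \<tau>)"
  have "flow_trajectory X Sing A (\<tau> / of_real (norm \<tau>)) ?\<gamma>"
    using mB BP line nonsing
    by (intro frac_orbit_flow_trajectory [OF conv _ _ \<tau> qm q charts]) auto
  \<comment> \<open>An earlier return would identify the boundary point \<open>m\<close> with an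
    interior point.\<close>
  moreover have "?\<gamma> t \<noteq> ?\<gamma> 0" if t: "0 < t" "t < norm \<tau>" for t
  proof
    assume eq: "?\<gamma> t = ?\<gamma> 0"
    have r: "0 < t / norm \<tau>" "t / norm \<tau> < 1" using t \<tau> by (simp_all add: divide_less_eq)
    then have fr: "frac (t / norm \<tau>) = t / norm \<tau>" by (simp add: frac_eq)
    define w where "w = m + (t / norm \<tau>) *\<^sub>R \<tau>"
    have w: "w \<in> interior ?P" using int r by (simp add: w_def)
    then have wP: "w \<in> ?P" using interior_subset by blast
    have "q w = q m" using eq by (simp add: fr w_def)
    then have "(w, m) \<in> (glue_rel vs \<pi> \<union> (glue_rel vs \<pi>)\<inverse>)\<^sup>*"
      using glue wP mB BP by blast
    then have "w = m \<or> w \<in> ?B"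
      using glue_equivalence(1) [OF vs \<pi>] by blast
    then show False using intB w mB by blast
  qed
  ultimately have "periodic_orbit X Sing A (\<tau> / of_real (norm \<tau>)) (norm \<tau>) ?\<gamma>"
    unfolding periodic_orbit_def using \<tau> qm by (simp add: norm_divide)
  then show ?thesis
    using frac_orbit_loop_class [OF \<tau> qm, of X] by blast
qed

text \<open>For a single gluing, consider the parallelogram \<open>x\<close>, \<open>m\<close>,
  \<open>m + \<tau>\<close>, \<open>x + \<tau>\<close>: its sides along the edges have equal images,
  so the other two sides agree modulo boundaries. This includes vertices, where the segment itself
  need not give an orbit.\<close>

lemma glued_segment_in_subgroup:
  assumes vs: "simple_polygon vs" and \<pi>: "edge_pairing vs \<pi>" and conv: "convex (poly_region vs)"
    and q: "continuous_map (top_of_set (poly_region vs)) X q"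
    and glue: "\<And>z w. (z, w) \<in> glue_rel vs \<pi> \<Longrightarrow> q z = q w"
    and N: "subgroup_above_boundaries X N"
    and mid: "\<And>i. i < length vs \<Longrightarrow>
      frag_of (segment_simplex q (poly_vertex vs i + (1/2) *\<^sub>R (poly_vertex vs (Suc i) - poly_vertex vs i))
        (poly_vertex vs i + (1/2) *\<^sub>R (poly_vertex vs (Suc i) - poly_vertex vs i) +
          (poly_vertex vs (Suc (\<pi> i)) - poly_vertex vs i))) \<in> N"
    and z: "z \<in> poly_region vs" and zw: "(z, w) \<in> (glue_rel vs \<pi> \<union> (glue_rel vs \<pi>)\<inverse>)\<^sup>*"
  shows "w \<in> poly_region vs \<and> frag_of (segment_simplex q z w) \<in> N"
proof -
  let ?P = "poly_region vs"
  let ?s = "\<lambda>z w. frag_of (segment_simplex q z w)"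
  have BP: "poly_boundary vs \<subseteq> ?P" by (simp add: poly_region_def)
  have EP: "poly_edge vs i \<subseteq> ?P" for i
    using BP poly_edge_subset_boundary [OF vs] by blast
  note bd = subgroup_above_boundaries_boundary [OF N] and add = subgroup_above_boundaries_add [OF N]
    and diff = subgroup_above_boundaries_diff [OF N]
  have tri: "?s a b + ?s b d - ?s a d \<in> N" if "a \<in> ?P" "b \<in> ?P" "d \<in> ?P" for a b d
    using relboundary_triangle [OF q conv that] by (rule bd)
  have refl: "?s a a \<in> N" if "a \<in> ?P" for a
    using tri [OF that that that] by simp
  have glued: "x \<in> ?P \<and> y \<in> ?P \<and> ?s x y \<in> N" if xy: "(x, y) \<in> glue_rel vs \<pi>" for x y
  proof -
    obtain i where i: "i < length vs" "x \<in> poly_edge vs i"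
      "y = x + (poly_vertex vs (Suc (\<pi> i)) - poly_vertex vs i)"
      using xy unfolding glue_rel_def by blast
    define \<tau> where "\<tau> = poly_vertex vs (Suc (\<pi> i)) - poly_vertex vs i"
    define m where "m = poly_vertex vs i + (1/2) *\<^sub>R (poly_vertex vs (Suc i) - poly_vertex vs i)"
    have trans: "(v, v + \<tau>) \<in> glue_rel vs \<pi>" if "v \<in> poly_edge vs i" for v
      unfolding glue_rel_def \<tau>_def using i(1) that by blast
    have m: "m \<in> poly_edge vs i"
      unfolding poly_edge_iff m_def by (intro exI [of _ "1/2"]) simp
    have P: "x \<in> ?P" "y \<in> ?P" "m \<in> ?P" "m + \<tau> \<in> ?P"
      using glue_rel_boundary [OF vs \<pi> xy] glue_rel_boundary [OF vs \<pi> trans [OF m]] BP by blast+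
    have y: "y = x + \<tau>" by (simp add: i \<tau>_def)
    have "q (c 0 *\<^sub>R x + c 1 *\<^sub>R m) = q (c 0 *\<^sub>R y + c 1 *\<^sub>R (m + \<tau>))"
      if c: "c \<in> standard_simplex 1" for c
    proof -
      have c01: "c 0 = 1 - c 1" "0 \<le> c 1" "c 1 \<le> 1"
        using c unfolding standard_simplex_1_iff by linarith+
      have "c 0 *\<^sub>R x + c 1 *\<^sub>R m \<in> poly_edge vs i"
        using i(2) m c01 convex_closed_segment unfolding poly_edge_def by (intro convexD) auto
      moreover have "c 0 *\<^sub>R y + c 1 *\<^sub>R (m + \<tau>) = c 0 *\<^sub>R x + c 1 *\<^sub>R m + \<tau>"
        by (simp add: y c01(1) algebra_simps)
      ultimately show ?thesis using glue trans by metis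
    qed
    then have "segment_simplex q x m = segment_simplex q y (m + \<tau>)"
      unfolding segment_simplex_def by (rule restrict_ext)
    moreover have "?s m (m + \<tau>) \<in> N"
      using mid [OF i(1)] by (simp only: m_def \<tau>_def)
    \<comment> \<open>The parallelogram is cut into two triangles along the diagonal from
      \<open>x\<close> to \<open>m + \<tau>\<close>.\<close>
    ultimately have "(?s x y + ?s y (m + \<tau>) - ?s x (m + \<tau>)) - (?s x m + ?s m (m + \<tau>) - ?s x (m + \<tau>))
        + ?s m (m + \<tau>) \<in> N" "segment_simplex q x m = segment_simplex q y (m + \<tau>)"
      using add [OF diff [OF tri [OF P(1,2,4)] tri [OF P(1,3,4)]]] by blast+
    then have "?s x y \<in> N" by (simp add: algebra_simps)
    then show ?thesis using P by blast
  qed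
  show ?thesis
    using zw
  proof (induction rule: rtrancl_induct)
    case base
    then show ?case using z refl by blast
  next
    case (step y w)
    have yw: "w \<in> ?P \<and> ?s y w \<in> N"
      using step.hyps(2)
    proof
      assume "(y, w) \<in> (glue_rel vs \<pi>)\<inverse>"
      then have g: "w \<in> ?P" "y \<in> ?P" "?s w y \<in> N" using glued by blast+
      \<comment> \<open>Reversal of a segment, by the degenerate triangle \<open>y\<close>,
        \<open>w\<close>, \<open>y\<close>.\<close>
      have "(?s y w + ?s w y - ?s y y) - ?s w y + ?s y y \<in> N"
        using add [OF diff [OF tri [OF g(2,1,2)] g(3)] refl [OF g(2)]] .
      then show ?thesis using g by (simp add: algebra_simps)
    qed (use glued in blast)
    have "?s z y + ?s y w - (?s z y + ?s y w - ?s z w) \<in> N"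
      using diff [OF add [OF conjunct2 [OF step.IH] conjunct2 [OF yw]] tri [OF z]] step.IH yw by blast
    then show ?case using yw by (simp add: algebra_simps)
  qed
qed

theorem proposition1:
  fixes X :: "'a topology" and Sing :: "'a set" and A :: "'a plane_chart set"
  assumes "convex_translation_surface X Sing A"
  shows "generate (homology_group 1 X)
           {loop_class X T \<gamma> | \<theta> T \<gamma>. periodic_orbit X Sing A \<theta> T \<gamma>}
         = carrier (homology_group 1 X)"
proof
  let ?H = "homology_group 1 X"
  let ?S = "{loop_class X T \<gamma> | \<theta> T \<gamma>. periodic_orbit X Sing A \<theta> T \<gamma>}"
  have S: "?S \<subseteq> carrier ?H"
    using loop_class_in_homology_group by blast
  then show "generate ?H ?S \<subseteq> carrier ?H"
    by (intro group.generate_incl) simp_all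
  obtain vs \<pi> where pat: "is_pattern X Sing A vs \<pi>" and conv: "convex (poly_region vs)"
    and surf: "topological_surface X"
    using assms unfolding convex_translation_surface_def translation_surface_def by blast
  then obtain q where vs: "simple_polygon vs" and \<pi>: "edge_pairing vs \<pi>"
    and quot: "quotient_map (top_of_set (poly_region vs)) X q"
    and glue: "\<forall>z \<in> poly_region vs. \<forall>w \<in> poly_region vs.
             q z = q w \<longleftrightarrow> (z, w) \<in> (glue_rel vs \<pi> \<union> (glue_rel vs \<pi>)\<inverse>)\<^sup>*"
    and Sing: "Sing \<subseteq> q ` set vs"
    and charts: "\<forall>(U, \<phi>) \<in> A. \<forall>z \<in> poly_region vs. q z \<in> U \<longrightarrow>
             (\<exists>c. \<exists>e > 0. \<forall>w \<in> poly_region vs \<inter> ball z e. \<phi> (q w) = w + c)"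
    unfolding is_pattern_def by blast
  let ?P = "poly_region vs"
  note q = quotient_imp_continuous_map [OF quot]
  \<comment> \<open>The goal becomes that every cycle lies in \<open>N\<close>; the criterion for
    quotients of convex sets then asks only for segments between identified points.\<close>
  define N where
    "N = {c. singular_relcycle 1 X {} c \<and> homologous_rel_set 1 X {} c \<in> generate ?H ?S}"
  have N: "subgroup_above_boundaries X N"
    unfolding N_def by (rule subgroup_above_boundaries_generate [OF S])
  have BP: "poly_boundary vs \<subseteq> ?P" by (simp add: poly_region_def)
  have glued: "x \<in> ?P \<and> y \<in> ?P \<and> q x = q y" if "(x, y) \<in> glue_rel vs \<pi>" for x y
  proof -
    have "x \<in> ?P" "y \<in> ?P" using glue_rel_boundary [OF vs \<pi> that] BP by blast+
    then show ?thesis using glue that by blast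
  qed
  have "frag_of (segment_simplex q (poly_vertex vs i + (1/2) *\<^sub>R (poly_vertex vs (Suc i) - poly_vertex vs i))
        (poly_vertex vs i + (1/2) *\<^sub>R (poly_vertex vs (Suc i) - poly_vertex vs i) +
          (poly_vertex vs (Suc (\<pi> i)) - poly_vertex vs i))) \<in> N" if i: "i < length vs" for i
  proof -
    define m where "m = poly_vertex vs i + (1/2) *\<^sub>R (poly_vertex vs (Suc i) - poly_vertex vs i)"
    define \<tau> where "\<tau> = poly_vertex vs (Suc (\<pi> i)) - poly_vertex vs i"
    have "homologous_rel_set 1 X {} (frag_of (segment_simplex q m (m + \<tau>))) \<in> ?S"
      using edge_midpoint_periodic_orbit [OF vs \<pi> conv q glue Sing charts i]
      unfolding m_def [symmetric] \<tau>_def [symmetric] by blast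
    then have "homologous_rel_set 1 X {} (frag_of (segment_simplex q m (m + \<tau>))) \<in> generate ?H ?S"
      by (rule generate.incl)
    moreover have "m \<in> poly_edge vs i"
      unfolding poly_edge_iff m_def by (intro exI [of _ "1/2"]) simp
    then have "(m, m + \<tau>) \<in> glue_rel vs \<pi>"
      unfolding glue_rel_def \<tau>_def using i by blast
    then have m: "m \<in> ?P" "m + \<tau> \<in> ?P" "q m = q (m + \<tau>)" using glued by blast+
    have "singular_relcycle 1 X {} (frag_of (segment_simplex q m (m + \<tau>)))"
      unfolding singular_cycle singular_chain_of chain_boundary_1_of
      using singular_simplex_segment [OF q closed_segment_subset [OF m(1,2) conv]] m(3) by simp
    ultimately show ?thesis by (simp add: N_def m_def \<tau>_def)
  qed
  then have seg: "frag_of (segment_simplex q z w) \<in> N" if "z \<in> ?P" "w \<in> ?P" "q z = q w" for z w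
    using glued_segment_in_subgroup [OF vs \<pi> conv q _ N _ that(1)] glued glue that by blast
  have "c \<in> N" if "singular_relcycle 1 X {} c" for c
    using cycle_in_subgroup_of_convex_quotient [OF surf conv compact_poly_region [OF vs] quot N seg that] .
  then show "carrier ?H \<subseteq> generate ?H ?S"
    using carrier_relative_homology_group [of 1 X "{}"] by (auto simp: N_def)
qed

end
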